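(* Let $A$ be a semisimple complex Banach algebra with identity. Let $\mathcal{P}$ be a set of projections of $A$ of rank at most one such that every element of $\mathrm{Soc}\,A$ is a finite sum of members of the two-sided ideals $J_p$ ($p\in\mathcal{P}$), and such that $J_pJ_q=J_qJ_p=\{0\}$ whenever $p,q\in\mathcal{P}$, $p\neq q$. Then there is an algebra isomorphism $$\mathrm{Soc}\,A\;\cong\;\bigoplus_{p\in\mathcal{P}} Ap\otimes pA .$$
   Context: A projection is an element $p$ with $p^2=p$. For $x\in A$, $\sigma(x)$ is the spectrum and $\sigma'(x)=\sigma(x)\setminus\{0\}$. The rank of $a\in A$ is $\mathrm{rank}(a)=\sup_{x\in A}\#\sigma'(xa)\in\{0,1,2,\dots\}\cup\{\infty\}$. $\mathrm{Soc}\,A$ is the socle of $A$ (the sum of all minimal left ideals, $\{0\}$ if there are none); for semisimple $A$ it coincides with the set of elements of finite rank. For a projection $p$ with $\mathrm{rank}(p)\le 1$, $J_p=\{\sum_{j=1}^n x_jpy_j : x_j,y_j\in A,\ n\ge 1\}$ is the two-sided ideal generated by $p$. A set $\mathcal{P}$ with the properties in the claim always exists (a known result); its elements index the ideals $J_p$, contained in $\mathrm{Soc}\,A$. $Ap\otimes pA$ is the algebraic tensor product of the complex vector spaces $Ap$ and $pA$. There is a linear map $\phi_p: Ap\otimes pA\to J_p$ with $\phi_p(x\otimes y)=xpy$, which is a linear bijection, and $Ap\otimes pA$ is made an algebra by the multiplication $uv=\phi_p^{-1}(\phi_p(u)\phi_p(v))$. (For $p$ of rank one, $y_1x_2\in pAp=\mathbb{C}p$,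 and if $y_1x_2=\lambda p$ then $(x_1\otimes y_1)(x_2\otimes y_2)=\lambda\,(x_1\otimes y_2)$.) The direct sum $\bigoplus_{p\in\mathcal{P}}Ap\otimes pA$ is the set of families in the Cartesian product that are zero except at finitely many $p$, with pointwise scalar multiplication, addition and multiplication. *)

theory Defs
  imports
    "HOL-Analysis.Analysis"
    "HOL-Library.Poly_Mapping"
    "HOL-Library.Extended_Nat"
    "HOL-Library.FuncSet"
begin

section \<open>Complex Banach algebras\<close>

class complex_vector = ab_group_add +
  fixes scaleC :: "complex \<Rightarrow> 'a \<Rightarrow> 'a"  (infixr \<open>*\<^sub>C\<close> 75)
  assumes scaleC_add_right: "a *\<^sub>C (x + y) = a *\<^sub>C x + a *\<^sub>C y"
    and scaleC_add_left: "(a + b) *\<^sub>C x = a *\<^sub>C x + b *\<^sub>C x"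
    and scaleC_scaleC: "a *\<^sub>C b *\<^sub>C x = (a * b) *\<^sub>C x"
    and scaleC_one: "1 *\<^sub>C x = x"

global_interpretation complex_vector:
  vector_space "scaleC :: complex \<Rightarrow> 'a \<Rightarrow> 'a::complex_vector"
  by unfold_locales (simp_all add: scaleC_add_right scaleC_add_left scaleC_scaleC scaleC_one)

text \<open>
  The identity comes from \<^class>\<open>monoid_mult\<close> rather than from \<^class>\<open>real_normed_algebra_1\<close>:
  neither \<open>1 \<noteq> 0\<close> nor \<open>norm 1 = 1\<close> is required.
\<close>

class complex_banach_algebra_1 = complex_vector + real_normed_algebra + banach + monoid_mult +
  assumes scaleR_scaleC: "r *\<^sub>R x = complex_of_real r *\<^sub>C x"
    and norm_scaleC: "norm (c *\<^sub>C x) = cmod c * norm x"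
    and mult_scaleC_left: "(c *\<^sub>C x) * y = c *\<^sub>C (x * y)"
    and mult_scaleC_right: "x * (c *\<^sub>C y) = c *\<^sub>C (x * y)"

instantiation complex :: complex_banach_algebra_1
begin
definition scaleC_complex :: "complex \<Rightarrow> complex \<Rightarrow> complex"
  where "scaleC_complex c x = c * x"
instance
  by standard (simp_all add: scaleC_complex_def algebra_simps norm_mult scaleR_conv_of_real)
end

section \<open>Ideals, semisimplicity and the socle\<close>

definition left_ideal :: "'a::complex_banach_algebra_1 set \<Rightarrow> bool"
  where "left_ideal L \<longleftrightarrow> complex_vector.subspace L \<and> (\<forall>a. \<forall>x\<in>L. a * x \<in> L)"

definition maximal_left_ideal :: "'a::complex_banach_algebra_1 set \<Rightarrow> bool"
  where "maximal_left_ideal L \<longleftrightarrow> left_ideal L \<and> L \<noteq> UNIV \<and>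
    (\<forall>M. left_ideal M \<longrightarrow> L \<subseteq> M \<longrightarrow> M = L \<or> M = UNIV)"

definition minimal_left_ideal :: "'a::complex_banach_algebra_1 set \<Rightarrow> bool"
  where "minimal_left_ideal L \<longleftrightarrow> left_ideal L \<and> L \<noteq> {0} \<and>
    (\<forall>M. left_ideal M \<longrightarrow> M \<subseteq> L \<longrightarrow> M = {0} \<or> M = L)"

definition jacobson_radical :: "'a::complex_banach_algebra_1 set"
  where "jacobson_radical = \<Inter> {L. maximal_left_ideal L}"

definition semisimple :: "'a::complex_banach_algebra_1 itself \<Rightarrow> bool"
  where "semisimple _ \<longleftrightarrow> (jacobson_radical :: 'a set) = {0}"

definition Soc :: "'a::complex_banach_algebra_1 set"
  where "Soc = {\<Sum>L\<in>F. f L | F f. finite F \<and> (\<forall>L\<in>F. minimal_left_ideal L \<and> f L \<in> L)}"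

section \<open>Spectrum, rank and projections\<close>

definition spectrum :: "'a::complex_banach_algebra_1 \<Rightarrow> complex set"
  where "spectrum x = {c. \<not> (\<exists>y. y * (c *\<^sub>C 1 - x) = 1 \<and> (c *\<^sub>C 1 - x) * y = 1)}"

definition ecard :: "'b set \<Rightarrow> enat"
  where "ecard S = (if finite S then enat (card S) else \<infinity>)"

definition elem_rank :: "'a::complex_banach_algebra_1 \<Rightarrow> enat"
  where "elem_rank a = (SUP x. ecard (spectrum (x * a) - {0}))"

definition projection :: "'a::complex_banach_algebra_1 \<Rightarrow> bool"
  where "projection p \<longleftrightarrow> p * p = p"

definition J :: "'a::complex_banach_algebra_1 \<Rightarrow> 'a set"
  where "J p = {\<Sum>j<n. x j * p * y j | (n::nat) x y. n \<ge> 1}"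

section \<open>Algebras with an explicit carrier\<close>

record 'b calg =
  alg_carrier :: "'b set"
  alg_zero :: 'b
  alg_add :: "'b \<Rightarrow> 'b \<Rightarrow> 'b"
  alg_mult :: "'b \<Rightarrow> 'b \<Rightarrow> 'b"
  alg_scale :: "complex \<Rightarrow> 'b \<Rightarrow> 'b"

definition alg_iso :: "'b calg \<Rightarrow> 'c calg \<Rightarrow> ('b \<Rightarrow> 'c) \<Rightarrow> bool"
  where "alg_iso B C h \<longleftrightarrow> bij_betw h (alg_carrier B) (alg_carrier C) \<and>
    (\<forall>x\<in>alg_carrier B. \<forall>y\<in>alg_carrier B. h (alg_add B x y) = alg_add C (h x) (h y)) \<and>
    (\<forall>x\<in>alg_carrier B. \<forall>y\<in>alg_carrier B. h (alg_mult B x y) = alg_mult C (h x) (h y)) \<and>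
    (\<forall>c. \<forall>x\<in>alg_carrier B. h (alg_scale B c x) = alg_scale C c (h x))"

definition alg_isomorphic :: "'b calg \<Rightarrow> 'c calg \<Rightarrow> bool"
  where "alg_isomorphic B C \<longleftrightarrow> (\<exists>h. alg_iso B C h)"

definition direct_sum :: "'i set \<Rightarrow> ('i \<Rightarrow> 'b calg) \<Rightarrow> ('i \<Rightarrow> 'b) calg"
  where "direct_sum I B =
    \<lparr>alg_carrier = {u \<in> (\<Pi>\<^sub>E i\<in>I. alg_carrier (B i)). finite {i\<in>I. u i \<noteq> alg_zero (B i)}},
     alg_zero = (\<lambda>i\<in>I. alg_zero (B i)),
     alg_add = (\<lambda>u v. \<lambda>i\<in>I. alg_add (B i) (u i) (v i)),
     alg_mult = (\<lambda>u v. \<lambda>i\<in>I. alg_mult (B i) (u i) (v i)),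
     alg_scale = (\<lambda>c u. \<lambda>i\<in>I. alg_scale (B i) c (u i))\<rparr>"

definition Soc_alg :: "'a::complex_banach_algebra_1 calg"
  where "Soc_alg =
    \<lparr>alg_carrier = Soc, alg_zero = 0, alg_add = (+), alg_mult = (*), alg_scale = scaleC\<rparr>"

section \<open>Algebraic tensor products of subspaces\<close>

instantiation poly_mapping :: (type, complex_vector) complex_vector
begin
definition scaleC_poly_mapping :: "complex \<Rightarrow> ('a \<Rightarrow>\<^sub>0 'b) \<Rightarrow> ('a \<Rightarrow>\<^sub>0 'b)"
  where "scaleC_poly_mapping c f = Poly_Mapping.map (scaleC c) f"
instance
proof
  have l: "Poly_Mapping.lookup (c *\<^sub>C f) k = c *\<^sub>C Poly_Mapping.lookup f k" for c and f :: "'a \<Rightarrow>\<^sub>0 'b" and k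
    by (simp add: scaleC_poly_mapping_def map.rep_eq when_def)
  fix a b :: complex and f g :: "'a \<Rightarrow>\<^sub>0 'b"
  show "a *\<^sub>C (f + g) = a *\<^sub>C f + a *\<^sub>C g" "(a + b) *\<^sub>C f = a *\<^sub>C f + b *\<^sub>C f"
    "a *\<^sub>C b *\<^sub>C f = (a * b) *\<^sub>C f" "1 *\<^sub>C f = f"
    by (rule poly_mapping_eqI;
        simp add: l Poly_Mapping.lookup_add scaleC_add_right scaleC_add_left scaleC_scaleC scaleC_one)+
qed
end

text \<open>
  For subspaces \<open>V\<close> and \<open>W\<close>, the tensor product is the free complex vector space on \<open>V \<times> W\<close>
  (finitely supported functions) modulo the span of the bilinearity relators.
\<close>

definition free_space ::
    "'v::complex_vector set \<Rightarrow> 'w::complex_vector set \<Rightarrow> ('v \<times> 'w \<Rightarrow>\<^sub>0 complex) set"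
  where "free_space V W = {f. Poly_Mapping.keys f \<subseteq> V \<times> W}"

definition bilinear_relators ::
    "'v::complex_vector set \<Rightarrow> 'w::complex_vector set \<Rightarrow> ('v \<times> 'w \<Rightarrow>\<^sub>0 complex) set"
  where "bilinear_relators V W =
    {Poly_Mapping.single (x + x', y) 1 - Poly_Mapping.single (x, y) 1 - Poly_Mapping.single (x', y) 1
      | x x' y. x \<in> V \<and> x' \<in> V \<and> y \<in> W} \<union>
    {Poly_Mapping.single (x, y + y') 1 - Poly_Mapping.single (x, y) 1 - Poly_Mapping.single (x, y') 1
      | x y y'. x \<in> V \<and> y \<in> W \<and> y' \<in> W} \<union>
    {Poly_Mapping.single (c *\<^sub>C x, y) 1 - c *\<^sub>C Poly_Mapping.single (x, y) 1
      | c x y. x \<in> V \<and> y \<in> W} \<union>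
    {Poly_Mapping.single (x, c *\<^sub>C y) 1 - c *\<^sub>C Poly_Mapping.single (x, y) 1
      | c x y. x \<in> V \<and> y \<in> W}"

definition tensor_rel ::
    "'v::complex_vector set \<Rightarrow> 'w::complex_vector set \<Rightarrow>
      (('v \<times> 'w \<Rightarrow>\<^sub>0 complex) \<times> ('v \<times> 'w \<Rightarrow>\<^sub>0 complex)) set"
  where "tensor_rel V W = {(f, g). f \<in> free_space V W \<and> g \<in> free_space V W \<and>
    f - g \<in> complex_vector.span (bilinear_relators V W)}"

definition tensor_space ::
    "'v::complex_vector set \<Rightarrow> 'w::complex_vector set \<Rightarrow> ('v \<times> 'w \<Rightarrow>\<^sub>0 complex) set set"
  where "tensor_space V W = free_space V W // tensor_rel V W"

definition tensor_zero ::
    "'v::complex_vector set \<Rightarrow> 'w::complex_vector set \<Rightarrow> ('v \<times> 'w \<Rightarrow>\<^sub>0 complex) set"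
  where "tensor_zero V W = tensor_rel V W `` {0}"

definition tensor_add ::
    "'v::complex_vector set \<Rightarrow> 'w::complex_vector set \<Rightarrow>
      ('v \<times> 'w \<Rightarrow>\<^sub>0 complex) set \<Rightarrow> ('v \<times> 'w \<Rightarrow>\<^sub>0 complex) set \<Rightarrow> ('v \<times> 'w \<Rightarrow>\<^sub>0 complex) set"
  where "tensor_add V W s t = (\<Union>f\<in>s. \<Union>g\<in>t. tensor_rel V W `` {f + g})"

definition tensor_scale ::
    "'v::complex_vector set \<Rightarrow> 'w::complex_vector set \<Rightarrow>
      complex \<Rightarrow> ('v \<times> 'w \<Rightarrow>\<^sub>0 complex) set \<Rightarrow> ('v \<times> 'w \<Rightarrow>\<^sub>0 complex) set"
  where "tensor_scale V W c s = (\<Union>f\<in>s. tensor_rel V W `` {c *\<^sub>C f})"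

definition elementary_tensor ::
    "'v::complex_vector set \<Rightarrow> 'w::complex_vector set \<Rightarrow> 'v \<Rightarrow> 'w \<Rightarrow> ('v \<times> 'w \<Rightarrow>\<^sub>0 complex) set"
  where "elementary_tensor V W x y = tensor_rel V W `` {Poly_Mapping.single (x, y) 1}"

lemma scaleC_poly_mapping_lookup:
  "Poly_Mapping.lookup (c *\<^sub>C f) k = c *\<^sub>C Poly_Mapping.lookup f k"
  by (simp add: scaleC_poly_mapping_def map.rep_eq when_def)

lemma subspace_free_space: "complex_vector.subspace (free_space V W)"
  unfolding complex_vector.subspace_def free_space_def
  by (auto simp: in_keys_iff scaleC_poly_mapping_lookup scaleC_complex_def
      dest!: subsetD[OF Poly_Mapping.keys_add])

lemma equiv_tensor_rel: "equiv (free_space V W) (tensor_rel V W)"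
proof (rule equivI)
  show "tensor_rel V W \<subseteq> free_space V W \<times> free_space V W"
    by (auto simp: tensor_rel_def)
  show "refl_on (free_space V W) (tensor_rel V W)"
    by (auto simp: refl_on_def tensor_rel_def complex_vector.span_zero)
  show "sym (tensor_rel V W)"
    unfolding sym_def tensor_rel_def
    using complex_vector.span_neg by fastforce
  show "trans (tensor_rel V W)"
  proof (rule transI)
    fix f g h assume *: "(f, g) \<in> tensor_rel V W" "(g, h) \<in> tensor_rel V W"
    have "f - h = (f - g) + (g - h)" by simp
    with * show "(f, h) \<in> tensor_rel V W"
      by (auto simp only: tensor_rel_def mem_Collect_eq case_prod_conv intro: complex_vector.span_add)
  qed
qed

lemma tensor_add_class:
  assumes "f \<in> free_space V W" "g \<in> free_space V W"
  shows "tensor_add V W (tensor_rel V W `` {f}) (tensor_rel V W `` {g}) = tensor_rel V W `` {f + g}"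
  unfolding tensor_add_def
proof (rule UN_equiv_class2[OF equiv_tensor_rel equiv_tensor_rel _ assms])
  show "congruent2 (tensor_rel V W) (tensor_rel V W) (\<lambda>f g. tensor_rel V W `` {f + g})"
  proof (rule congruent2I')
    fix f f' g g' assume *: "(f, f') \<in> tensor_rel V W" "(g, g') \<in> tensor_rel V W"
    have "f + g - (f' + g') = (f - f') + (g - g')" by simp
    with * have "(f + g, f' + g') \<in> tensor_rel V W"
      using complex_vector.subspace_add[OF subspace_free_space[of V W]]
      by (auto simp only: tensor_rel_def mem_Collect_eq case_prod_conv intro: complex_vector.span_add)
    then show "tensor_rel V W `` {f + g} = tensor_rel V W `` {f' + g'}"
      by (rule equiv_class_eq[OF equiv_tensor_rel])
  qed
qed

lemma tensor_scale_class:
  assumes "f \<in> free_space V W"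
  shows "tensor_scale V W c (tensor_rel V W `` {f}) = tensor_rel V W `` {c *\<^sub>C f}"
  unfolding tensor_scale_def
proof (rule UN_equiv_class[OF equiv_tensor_rel _ assms])
  show "congruent (tensor_rel V W) (\<lambda>f. tensor_rel V W `` {c *\<^sub>C f})"
  proof (rule congruentI)
    fix f f' assume *: "(f, f') \<in> tensor_rel V W"
    have "c *\<^sub>C f - c *\<^sub>C f' = c *\<^sub>C (f - f')" by (simp add: complex_vector.scale_right_diff_distrib)
    with * have "(c *\<^sub>C f, c *\<^sub>C f') \<in> tensor_rel V W"
      using complex_vector.subspace_scale[OF subspace_free_space[of V W]]
      by (auto simp only: tensor_rel_def mem_Collect_eq case_prod_conv intro: complex_vector.span_scale)
    then show "tensor_rel V W `` {c *\<^sub>C f} = tensor_rel V W `` {c *\<^sub>C f'}"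
      by (rule equiv_class_eq[OF equiv_tensor_rel])
  qed
qed

section \<open>The algebra on \<open>Ap \<otimes> pA\<close>\<close>

definition left_mults :: "'a::complex_banach_algebra_1 \<Rightarrow> 'a set"
  where "left_mults p = {a * p | a. True}"

definition right_mults :: "'a::complex_banach_algebra_1 \<Rightarrow> 'a set"
  where "right_mults p = {p * a | a. True}"

text \<open>
  \<open>free_phi p\<close> is the linear extension of \<open>(x, y) \<mapsto> x p y\<close> to the free vector space. It is
  constant on every class, and \<open>phi p\<close> is the induced map on \<open>Ap \<otimes> pA\<close>; see \<open>phi_class\<close>
  and \<open>phi_elementary\<close>.
\<close>

definition free_phi :: "'a::complex_banach_algebra_1 \<Rightarrow> ('a \<times> 'a \<Rightarrow>\<^sub>0 complex) \<Rightarrow> 'a"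
  where "free_phi p f = (\<Sum>(x, y)\<in>Poly_Mapping.keys f. Poly_Mapping.lookup f (x, y) *\<^sub>C (x * p * y))"

definition phi :: "'a::complex_banach_algebra_1 \<Rightarrow> ('a \<times> 'a \<Rightarrow>\<^sub>0 complex) set \<Rightarrow> 'a"
  where "phi p t = the_elem (free_phi p ` t)"

lemma free_phi_sum:
  assumes "finite S" "Poly_Mapping.keys f \<subseteq> S"
  shows "free_phi p f = (\<Sum>(x, y)\<in>S. Poly_Mapping.lookup f (x, y) *\<^sub>C (x * p * y))"
  unfolding free_phi_def using assms
  by (intro sum.mono_neutral_left) (auto simp: in_keys_iff)

lemma free_phi_add: "free_phi p (f + g) = free_phi p f + free_phi p g"
proof -
  let ?S = "Poly_Mapping.keys f \<union> Poly_Mapping.keys g"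
  have "Poly_Mapping.keys (f + g) \<subseteq> ?S" by (rule Poly_Mapping.keys_add)
  then show ?thesis
    by (simp add: free_phi_sum[of ?S] Poly_Mapping.lookup_add scaleC_add_left sum.distrib
        case_prod_unfold)
qed

lemma free_phi_scale: "free_phi p (c *\<^sub>C f) = c *\<^sub>C free_phi p f"
proof -
  have "Poly_Mapping.keys (c *\<^sub>C f) \<subseteq> Poly_Mapping.keys f"
    by (auto simp: in_keys_iff scaleC_poly_mapping_lookup scaleC_complex_def)
  then show ?thesis
    by (simp add: free_phi_sum[of "Poly_Mapping.keys f"] scaleC_poly_mapping_lookup
        scaleC_complex_def scaleC_scaleC complex_vector.scale_sum_right case_prod_unfold)
qed

lemma free_phi_diff: "free_phi p (f - g) = free_phi p f - free_phi p g"
  using free_phi_add[of p "f - g" g] by (simp add: algebra_simps)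

lemma free_phi_single: "free_phi p (Poly_Mapping.single (x, y) 1) = x * p * y"
  by (simp add: free_phi_def scaleC_one)

lemma free_phi_span:
  assumes "f \<in> complex_vector.span (bilinear_relators V W)"
  shows "free_phi p f = 0"
  using assms
proof (induction rule: complex_vector.span_induct)
  case base
  show ?case
    by (auto simp: complex_vector.subspace_def free_phi_add free_phi_scale) (simp add: free_phi_def)
next
  case (step f)
  then show ?case
    by (auto simp: bilinear_relators_def free_phi_diff free_phi_scale free_phi_single distrib_left
        distrib_right mult_scaleC_left mult_scaleC_right)
qed

lemma phi_class:
  assumes "f \<in> free_space V W"
  shows "phi p (tensor_rel V W `` {f}) = free_phi p f"
proof -
  have "free_phi p g = free_phi p f" if "g \<in> tensor_rel V W `` {f}" for g
    using that free_phi_span[of "f - g" V W p] by (auto simp: tensor_rel_def free_phi_diff)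
  moreover have "f \<in> tensor_rel V W `` {f}"
    using assms equiv_class_self[OF equiv_tensor_rel] by blast
  ultimately have "free_phi p ` (tensor_rel V W `` {f}) = {free_phi p f}"
    by (intro equalityI subsetI) (blast, metis imageI singletonD)
  then show ?thesis by (simp add: phi_def)
qed

lemma phi_elementary:
  assumes "x \<in> V" "y \<in> W"
  shows "phi p (elementary_tensor V W x y) = x * p * y"
  unfolding elementary_tensor_def
  by (subst phi_class) (use assms in \<open>auto simp: free_space_def free_phi_single\<close>)

lemma phi_add:
  assumes "s \<in> tensor_space V W" "t \<in> tensor_space V W"
  shows "phi p (tensor_add V W s t) = phi p s + phi p t"
proof -
  obtain f g where f: "f \<in> free_space V W" "s = tensor_rel V W `` {f}"
    and g: "g \<in> free_space V W" "t = tensor_rel V W `` {g}"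
    using assms unfolding tensor_space_def by (meson quotientE)
  have "f + g \<in> free_space V W"
    using f(1) g(1) by (rule complex_vector.subspace_add[OF subspace_free_space])
  then show ?thesis
    unfolding f(2) g(2) tensor_add_class[OF f(1) g(1)]
    by (simp only: phi_class f(1) g(1) free_phi_add)
qed

lemma phi_scale:
  assumes "s \<in> tensor_space V W"
  shows "phi p (tensor_scale V W c s) = c *\<^sub>C phi p s"
proof -
  obtain f where f: "f \<in> free_space V W" "s = tensor_rel V W `` {f}"
    using assms unfolding tensor_space_def by (meson quotientE)
  have "c *\<^sub>C f \<in> free_space V W"
    using f(1) by (rule complex_vector.subspace_scale[OF subspace_free_space])
  then show ?thesis
    unfolding f(2) tensor_scale_class[OF f(1)]
    by (simp only: phi_class f(1) free_phi_scale)
qed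

definition Ap_tensor_pA :: "'a::complex_banach_algebra_1 \<Rightarrow> ('a \<times> 'a \<Rightarrow>\<^sub>0 complex) set calg"
  where "Ap_tensor_pA p =
    (let V = left_mults p; W = right_mults p in
    \<lparr>alg_carrier = tensor_space V W,
     alg_zero = tensor_zero V W,
     alg_add = tensor_add V W,
     alg_mult = (\<lambda>u v. inv_into (tensor_space V W) (phi p) (phi p u * phi p v)),
     alg_scale = tensor_scale V W\<rparr>)"

end

theory Submission
  imports Defs
begin

text \<open>
  If \<open>p\<close> is a projection of rank at most one, then \<open>pAp = \<complex>p\<close>: each element of the corner has a spectral
  value in the corner, and a non-invertible element \<open>q\<close> of \<open>pAp\<close> is quasi-regular in \<open>A\<close> because two
  distinct nonzero spectral values in \<open>Ap\<close> are excluded, so \<open>q = 0\<close> by semisimplicity. Consequently every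
  nonzero \<open>xp\<close> satisfies \<open>paxp = p\<close> for some \<open>a\<close>. This makes the left ideals \<open>Apy\<close> minimal (so
  \<open>J\<^sub>p \<subseteq> Soc A\<close>) and \<open>\<phi>\<^sub>p\<close> injective. The sum of the \<open>J\<^sub>p\<close> is direct since an element of \<open>J\<^sub>q\<close>
  annihilated by \<open>J\<^sub>q\<close> vanishes.
\<close>

section \<open>Nonemptiness of the spectrum\<close>

text \<open>The rank condition limits only the nonzero spectral values, so a corner element
  \<open>b\<close> with \<open>spectrum b\<close> inside {0} escapes it. That such an element is not
  invertible in a nonzero corner needs an analytic argument, and this is where nonemptiness of the
  spectrum enters. The corner is never made a Banach algebra of its own: all computations stay in A
  with p as a relative unit, and as the norm of 1 need not be 1, it is carried through the
  estimates. The isomorphism is built from the direct sum to the socle, where it is an explicit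
  finite sum; in the other direction a decomposition of every socle element would have to be
  chosen.\<close>

text \<open>
  Rickart's argument, which avoids vector-valued complex analysis: averaging the resolvent
  \<open>R z = (1 - zb)\<^sup>-\<^sup>1\<close> over \<open>z = \<omega>r\<close> with \<open>\<omega>\<^sup>n = 1\<close> yields \<open>(1 - r\<^sup>nb\<^sup>n)\<^sup>-\<^sup>1\<close>. If \<open>R\<close> is defined
  everywhere, these averages are equicontinuous in \<open>r\<close>, so \<open>r\<^sup>nb\<^sup>n \<longlonglongrightarrow> 0\<close> propagates from \<open>r = 0\<close> to all
  \<open>r\<close>. In particular \<open>b\<close> is not invertible in any nonzero corner.
\<close>

lemma power_scaleC:
  fixes b :: "'a::complex_banach_algebra_1"
  shows "(z *\<^sub>C b) ^ n = z ^ n *\<^sub>C b ^ n"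
  by (induction n) (simp_all add: scaleC_one mult_scaleC_left mult_scaleC_right scaleC_scaleC)

lemma sum_powers_mult_one_minus:
  fixes c :: "'a::complex_banach_algebra_1"
  shows "(\<Sum>k<n. c ^ k) * (1 - c) = 1 - c ^ n"
proof (induction n)
  case (Suc n)
  have "(\<Sum>k<Suc n. c ^ k) * (1 - c) = (\<Sum>k<n. c ^ k) * (1 - c) + c ^ n * (1 - c)"
    by (simp add: distrib_right)
  also have "c ^ n * (1 - c) = c ^ n - c ^ Suc n"
    by (simp add: right_diff_distrib power_commutes)
  finally show ?case by (simp add: Suc.IH)
qed simp

section \<open>Sums of powers of roots of unity\<close>

lemma root_of_unity_power:
  assumes "n > 0"
  shows "cis (2 * pi * real j / real n) ^ n = 1"
proof -
  have "real n * (2 * pi * real j / real n) = 2 * pi * real j"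
    using assms by simp
  then show ?thesis
    by (simp only: Complex.DeMoivre cis_multiple_2pi[OF Ints_of_nat])
qed

lemma sum_roots_of_unity_power:
  assumes "k < n"
  shows "(\<Sum>j<n. cis (2 * pi * real j / real n) ^ k) = (if k = 0 then of_nat n else 0)"
proof (cases "k = 0")
  case False
  let ?w = "cis (2 * pi * real k / real n)"
  \<comment> \<open>Exchanging j and k in the angle makes the sum over j a geometric series with the
    fixed ratio \<open>?w\<close>, which differs from 1 because 0 < k < n.\<close>
  have "?w ^ j = cis (2 * pi * real j / real n) ^ k" for j
  proof -
    have "real j * (2 * pi * real k / real n) = real k * (2 * pi * real j / real n)"
      by simp
    then show ?thesis by (simp only: Complex.DeMoivre)
  qed
  then have "(\<Sum>j<n. cis (2 * pi * real j / real n) ^ k) = (\<Sum>j<n. ?w ^ j)"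
    by simp
  also have "?w \<noteq> 1"
  proof
    assume "?w = 1"
    then have "cos (2 * pi * real k / real n) = 1"
      by (metis cis.sel(1) one_complex.sel(1))
    then obtain i :: int where "2 * pi * real k / real n = of_int i * 2 * pi"
      using cos_one_2pi_int by blast
    then have "real k = of_int i * real n"
      using assms by (simp add: field_simps)
    then have "int k = i * int n"
      by (metis of_int_eq_iff of_int_mult of_int_of_nat_eq)
    with False assms show False
      by (metis dvd_triv_right int_dvd_int_iff nat_dvd_not_less neq0_conv)
  qed
  then have "(\<Sum>j<n. ?w ^ j) = (?w ^ n - 1) / (?w - 1)"
    by (rule geometric_sum)
  also have "?w ^ n = 1"
    using assms by (simp add: root_of_unity_power)
  finally show ?thesis using False by simp
qed simp

text \<open>The assumption says that b has no nonzero spectral value. Nilpotent elements satisfy it,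
  so the aim is decay of the powers of b, not a contradiction.\<close>

context
  fixes b :: "'a::complex_banach_algebra_1" and R :: "complex \<Rightarrow> 'a"
  assumes R_left: "\<And>z. R z * (1 - z *\<^sub>C b) = 1" and R_right: "\<And>z. (1 - z *\<^sub>C b) * R z = 1"
begin

lemma resolvent_diff: "R z - R w = (z - w) *\<^sub>C (R z * b * R w)"
proof -
  have "(z - w) *\<^sub>C (R z * b * R w) = R z * ((1 - w *\<^sub>C b) - (1 - z *\<^sub>C b)) * R w"
    by (simp add: algebra_simps mult_scaleC_left mult_scaleC_right
        complex_vector.scale_left_diff_distrib)
  also have "\<dots> = R z * ((1 - w *\<^sub>C b) * R w) - (R z * (1 - z *\<^sub>C b)) * R w"
    by (simp only: left_diff_distrib right_diff_distrib mult.assoc)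
  finally show ?thesis by (simp add: R_left R_right)
qed

text \<open>The resolvent identity bounds the difference by a multiple of \<open>norm (R z)\<close>,
  which is not known in advance. For z close to w the difference is at most half of
  \<open>norm (R z)\<close>; this forces \<open>norm (R z)\<close> below
  \<open>2 * norm (R w)\<close> and closes the circle.\<close>

lemma continuous_resolvent: "continuous_on UNIV R"
  unfolding continuous_on_iff
proof (intro ballI allI impI, simp)
  fix w :: complex and e :: real
  assume "e > 0"
  \<comment> \<open>The summand 1 keeps \<open>K\<close> positive even for b = 0, so that it can be
    divided by; \<open>M + 1\<close> below serves the same purpose.\<close>
  define K where "K = norm b * norm (R w) + 1"
  define M where "M = 2 * norm (R w) * K"
  have K: "K > 0" by (simp add: K_def add_nonneg_pos)
  have M: "M \<ge> 0" using K by (simp add: M_def)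
  have bnd: "norm (R z - R w) \<le> cmod (z - w) * norm (R z) * K" for z
  proof -
    have "norm (R z - R w) = cmod (z - w) * norm (R z * (b * R w))"
      by (simp add: resolvent_diff norm_scaleC mult.assoc)
    also have "\<dots> \<le> cmod (z - w) * (norm (R z) * (norm b * norm (R w)))"
      by (intro mult_left_mono order_trans[OF norm_mult_ineq] norm_mult_ineq) auto
    also have "\<dots> \<le> cmod (z - w) * (norm (R z) * K)"
      by (intro mult_left_mono) (auto simp: K_def)
    finally show ?thesis by (simp add: mult_ac)
  qed
  have "dist (R z) (R w) < e" if z: "dist z w < min (1 / (2 * K)) (e / (M + 1))" for z
  proof -
    have "cmod (z - w) * K \<le> 1 / 2"
      using z K by (simp add: dist_norm field_simps)
    then have "norm (R z) * (cmod (z - w) * K) \<le> norm (R z) * (1 / 2)"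
      by (intro mult_left_mono) auto
    then have "norm (R z - R w) \<le> norm (R z) / 2"
      using bnd[of z] by (simp add: mult_ac)
    moreover have "norm (R z) \<le> norm (R w) + norm (R z - R w)"
      by (metis add.commute norm_triangle_sub)
    ultimately have "norm (R z) \<le> 2 * norm (R w)" by linarith
    then have "cmod (z - w) * norm (R z) * K \<le> cmod (z - w) * (2 * norm (R w)) * K"
      using K by (intro mult_right_mono mult_left_mono) auto
    then have "norm (R z - R w) \<le> cmod (z - w) * M"
      using bnd[of z] by (simp add: M_def mult_ac)
    also have "\<dots> \<le> cmod (z - w) * (M + 1)"
      by (intro mult_left_mono) auto
    also have "\<dots> < e"
      using z M by (simp add: dist_norm field_simps)
    finally show ?thesis by (simp add: dist_norm)
  qed
  then show "\<exists>d>0. \<forall>z. dist z w < d \<longrightarrow> dist (R z) (R w) < e"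
    using \<open>e > 0\<close> K M by (intro exI[of _ "min (1 / (2 * K)) (e / (M + 1))"]) auto
qed

definition resolvent_mean :: "nat \<Rightarrow> real \<Rightarrow> 'a" where
  "resolvent_mean n r = (1 / of_nat n) *\<^sub>C (\<Sum>j<n. R (cis (2 * pi * real j / real n) * of_real r))"

text \<open>For each root of unity, r^n b^n is the n-th power of the same element d, namely b times
  the sample point, so the left factor times R there is a finite geometric sum in d. Summing over
  the roots annihilates every term except k = 0.\<close>

lemma resolvent_mean_inverse:
  assumes "n > 0"
  shows "(1 - of_real r ^ n *\<^sub>C b ^ n) * resolvent_mean n r = 1"
proof -
  let ?w = "\<lambda>j. cis (2 * pi * real j / real n)"
  have 1: "(1 - of_real r ^ n *\<^sub>C b ^ n) * R (?w j * of_real r)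
      = (\<Sum>k<n. ?w j ^ k *\<^sub>C of_real r ^ k *\<^sub>C b ^ k)" for j
  proof -
    let ?d = "(?w j * of_real r) *\<^sub>C b"
    have "?w j ^ n = 1"
      using assms by (simp add: root_of_unity_power)
    then have "?d ^ n = of_real r ^ n *\<^sub>C b ^ n"
      by (simp add: power_scaleC power_mult_distrib)
    then have "(1 - of_real r ^ n *\<^sub>C b ^ n) * R (?w j * of_real r)
        = (\<Sum>k<n. ?d ^ k) * (1 - ?d) * R (?w j * of_real r)"
      by (simp add: sum_powers_mult_one_minus)
    also have "\<dots> = (\<Sum>k<n. ?d ^ k)"
      by (simp add: mult.assoc R_right)
    finally show ?thesis
      by (simp add: power_scaleC power_mult_distrib scaleC_scaleC)
  qed
  have "(1 - of_real r ^ n *\<^sub>C b ^ n) * (\<Sum>j<n. R (?w j * of_real r))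
      = (\<Sum>j<n. \<Sum>k<n. ?w j ^ k *\<^sub>C of_real r ^ k *\<^sub>C b ^ k)"
    by (simp add: sum_distrib_left 1)
  also have "\<dots> = (\<Sum>k<n. (\<Sum>j<n. ?w j ^ k) *\<^sub>C of_real r ^ k *\<^sub>C b ^ k)"
    by (subst sum.swap) (simp only: complex_vector.scale_sum_left)
  also have "\<dots> = (\<Sum>k<n. if k = 0 then of_nat n *\<^sub>C 1 else 0)"
    by (intro sum.cong) (auto simp: sum_roots_of_unity_power scaleC_one)
  also have "\<dots> = of_nat n *\<^sub>C 1"
    using assms by (simp add: sum.delta)
  finally show ?thesis
    using assms by (simp add: resolvent_mean_def mult_scaleC_right scaleC_scaleC scaleC_one)
qed

lemma resolvent_mean_near_one:
  assumes "n > 0" and small: "\<bar>r\<bar> ^ n * norm (b ^ n) \<le> 1 / 2"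
  shows "norm (resolvent_mean n r - 1) \<le> 2 * norm (1 :: 'a) * (\<bar>r\<bar> ^ n * norm (b ^ n))"
proof -
  let ?c = "of_real r ^ n *\<^sub>C b ^ n" and ?F = "resolvent_mean n r"
  let ?s = "\<bar>r\<bar> ^ n * norm (b ^ n)"
  have c: "norm ?c = ?s" by (simp add: norm_scaleC norm_power)
  \<comment> \<open>As \<open>?c\<close> has norm at most 1/2, this relation first bounds
    \<open>?F\<close> by twice the norm of 1 and then, used again, bounds \<open>?F - 1\<close> in
    terms of \<open>?c\<close>.\<close>
  have eq: "?F - 1 = ?c * ?F"
    using resolvent_mean_inverse[OF assms(1), of r] by (simp add: algebra_simps)
  then have le: "norm (?F - 1) \<le> ?s * norm ?F"
    using norm_mult_ineq[of ?c ?F] c by simp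
  also have "\<dots> \<le> 1 / 2 * norm ?F"
    using small by (intro mult_right_mono) auto
  finally have "norm ?F \<le> 2 * norm (1 :: 'a)"
    using norm_triangle_sub[of ?F 1] by simp
  then have "?s * norm ?F \<le> ?s * (2 * norm (1 :: 'a))"
    by (intro mult_left_mono) auto
  with le show ?thesis by (simp add: mult_ac)
qed

text \<open>The inverse relation is solved for the power term, whose norm reappears on the right
  with factor 1/2 and is absorbed. Only boundedness results; decay is regained later at a smaller
  radius.\<close>

lemma power_bounded_if_resolvent_mean_near_one:
  assumes "n > 0" and near: "norm (resolvent_mean n r - 1) \<le> 1 / 2"
  shows "\<bar>r\<bar> ^ n * norm (b ^ n) \<le> norm (1 :: 'a)"
proof -
  let ?c = "of_real r ^ n *\<^sub>C b ^ n" and ?F = "resolvent_mean n r"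
  have eq: "?c = (1 - ?c) * (?F - 1)"
    using resolvent_mean_inverse[OF assms(1), of r] by (simp add: algebra_simps)
  have "norm ?c \<le> norm (1 - ?c) * norm (?F - 1)"
    by (subst eq) (rule norm_mult_ineq)
  also have "\<dots> \<le> norm (1 - ?c) * (1 / 2)"
    using near by (intro mult_left_mono) auto
  also have "\<dots> \<le> (norm (1 :: 'a) + norm ?c) * (1 / 2)"
    by (intro mult_right_mono norm_triangle_ineq4) auto
  finally show ?thesis by (simp add: norm_scaleC norm_power)
qed

text \<open>Multiplication by a root of unity is an isometry, so for every n and every root the two
  sample points are |r - s| apart and stay in the disc of radius B. One modulus of uniform
  continuity of R thus serves all n.\<close>

lemma resolvent_mean_equicontinuous:
  assumes "e > 0"
  obtains d where "d > 0"
    "\<And>n r s. n > 0 \<Longrightarrow> \<bar>r\<bar> \<le> B \<Longrightarrow> \<bar>s\<bar> \<le> B \<Longrightarrow> \<bar>r - s\<bar> < d \<Longrightarrow>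
      norm (resolvent_mean n r - resolvent_mean n s) \<le> e"
proof -
  have "uniformly_continuous_on (cball 0 B) R"
    by (intro compact_uniformly_continuous continuous_on_subset[OF continuous_resolvent]) auto
  then obtain d where d: "d > 0"
    and uc: "\<And>z w. z \<in> cball 0 B \<Longrightarrow> w \<in> cball 0 B \<Longrightarrow> dist z w < d \<Longrightarrow> dist (R z) (R w) < e"
    using assms unfolding uniformly_continuous_on_def by metis
  have "norm (resolvent_mean n r - resolvent_mean n s) \<le> e"
    if n: "n > 0" and rs: "\<bar>r\<bar> \<le> B" "\<bar>s\<bar> \<le> B" "\<bar>r - s\<bar> < d" for n r s
  proof -
    let ?w = "\<lambda>j. cis (2 * pi * real j / real n)"
    have "norm (R (?w j * of_real r) - R (?w j * of_real s)) \<le> e" for j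
    proof -
      have "dist (?w j * of_real r) (?w j * of_real s) = \<bar>r - s\<bar>"
        by (simp add: dist_norm norm_mult flip: right_diff_distrib of_real_diff)
      then show ?thesis
        using uc[of "?w j * of_real r" "?w j * of_real s"] rs by (simp add: dist_norm norm_mult)
    qed
    then have "(\<Sum>j<n. norm (R (?w j * of_real r) - R (?w j * of_real s))) \<le> real n * e"
      by (intro order_trans[OF sum_bounded_above[where K = e]]) auto
    then have "norm (\<Sum>j<n. R (?w j * of_real r) - R (?w j * of_real s)) \<le> real n * e"
      by (rule order_trans[OF norm_sum])
    moreover have "norm (resolvent_mean n r - resolvent_mean n s)
        = 1 / real n * norm (\<Sum>j<n. R (?w j * of_real r) - R (?w j * of_real s))"
      by (simp add: resolvent_mean_def sum_subtractf norm_scaleC norm_divide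
          flip: complex_vector.scale_right_diff_distrib)
    ultimately show ?thesis
      using n by (simp only: mult.commute[of "real n"]) (simp add: divide_le_eq)
  qed
  with d that show ?thesis by blast
qed

text \<open>The step length \<open>d\<close> depends only on \<open>B\<close>, so finitely many steps exhaust \<open>[0, B]\<close>.\<close>

lemma power_decay_step:
  assumes "B > 0"
  obtains d where "d > 0"
    "\<And>s r. 0 \<le> s \<Longrightarrow> 0 \<le> r \<Longrightarrow> r < s + d \<Longrightarrow> r < B \<Longrightarrow> s < B \<Longrightarrow>
      (\<lambda>n. s ^ n * norm (b ^ n)) \<longlonglongrightarrow> 0 \<Longrightarrow> (\<lambda>n. r ^ n * norm (b ^ n)) \<longlonglongrightarrow> 0"
proof -
  obtain d where d: "d > 0" and equi:
    "\<And>n r s. n > 0 \<Longrightarrow> \<bar>r\<bar> \<le> B \<Longrightarrow> \<bar>s\<bar> \<le> B \<Longrightarrow> \<bar>r - s\<bar> < d \<Longrightarrow>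
      norm (resolvent_mean n r - resolvent_mean n s) \<le> 1 / 4"
    by (rule resolvent_mean_equicontinuous[of "1 / 4" B]) auto
  have "(\<lambda>n. r ^ n * norm (b ^ n)) \<longlonglongrightarrow> 0"
    if s: "0 \<le> s" "s < B" and r: "0 \<le> r" "r < s + d" "r < B"
      and lim: "(\<lambda>n. s ^ n * norm (b ^ n)) \<longlonglongrightarrow> 0" for s r
  proof -
    \<comment> \<open>A bound at a radius \<open>t\<close> beyond \<open>r\<close> suffices: the
      ratio r / t < 1 turns it into decay at \<open>r\<close>.\<close>
    obtain t where t: "r < t" "s < t" "t < s + d" "t < B"
      using dense[of "max r s" "min (s + d) B"] s r d by auto
    \<comment> \<open>The part 1/2 meets the premise of \<open>resolvent_mean_near_one\<close>. The
      other part makes its bound at most 1/4, which with the 1/4 from \<open>equi\<close> gives the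
      1/2 that \<open>power_bounded_if_resolvent_mean_near_one\<close> asks for.\<close>
    define \<epsilon> where "\<epsilon> = min (1 / 2) (1 / (8 * (norm (1 :: 'a) + 1)))"
    have "\<epsilon> > 0" by (auto simp: \<epsilon>_def add_nonneg_pos)
    then have ev: "eventually (\<lambda>n. s ^ n * norm (b ^ n) < \<epsilon> \<and> n > 0) sequentially"
      using order_tendstoD(2)[OF lim] eventually_gt_at_top by (intro eventually_conj) auto
    have bound: "t ^ n * norm (b ^ n) \<le> norm (1 :: 'a)" if n: "s ^ n * norm (b ^ n) < \<epsilon> \<and> n > 0" for n
    proof -
      have "norm (resolvent_mean n s - 1) \<le> 2 * norm (1 :: 'a) * (s ^ n * norm (b ^ n))"
        using resolvent_mean_near_one[of n s] n s by (auto simp: \<epsilon>_def)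
      also have "\<dots> \<le> 2 * (norm (1 :: 'a) + 1) * (1 / (8 * (norm (1 :: 'a) + 1)))"
        using n s by (intro mult_mono) (auto simp: \<epsilon>_def)
      also have "\<dots> = 1 / 4"
        using norm_ge_zero[of "1::'a"] by (simp add: field_simps add_nonneg_eq_0_iff)
      finally have "norm (resolvent_mean n s - 1) \<le> 1 / 4" .
      moreover have "norm (resolvent_mean n t - resolvent_mean n s) \<le> 1 / 4"
        using n s t by (intro equi) auto
      moreover have "norm (resolvent_mean n t - 1) \<le>
          norm (resolvent_mean n t - resolvent_mean n s) + norm (resolvent_mean n s - 1)"
        using norm_triangle_ineq[of "resolvent_mean n t - resolvent_mean n s" "resolvent_mean n s - 1"]
        by simp
      ultimately show ?thesis
        using power_bounded_if_resolvent_mean_near_one[of n t] n s t by simp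
    qed
    have "(\<lambda>n. (r / t) ^ n * norm (1 :: 'a)) \<longlonglongrightarrow> 0"
      using r t s by (intro tendsto_mult_left_zero LIMSEQ_power_zero) auto
    then show ?thesis
    proof (rule Lim_null_comparison[rotated])
      show "\<forall>\<^sub>F n in sequentially. norm (r ^ n * norm (b ^ n)) \<le> (r / t) ^ n * norm (1 :: 'a)"
        using ev
      proof eventually_elim
        case (elim n)
        have "r ^ n * norm (b ^ n) = (r / t) ^ n * (t ^ n * norm (b ^ n))"
          using t r by (simp add: power_divide)
        also have "\<dots> \<le> (r / t) ^ n * norm (1 :: 'a)"
          using bound[OF elim] t r by (intro mult_left_mono) auto
        finally show ?case using r by simp
      qed
    qed
  qed
  with d that show ?thesis by blast
qed

lemma power_decay:
  assumes "r \<ge> 0"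
  shows "(\<lambda>n. r ^ n * norm (b ^ n)) \<longlonglongrightarrow> 0"
proof -
  define B where "B = r + 1"
  have "B > 0" using assms by (simp add: B_def)
  then obtain d where d: "d > 0" and step:
    "\<And>s r. 0 \<le> s \<Longrightarrow> 0 \<le> r \<Longrightarrow> r < s + d \<Longrightarrow> r < B \<Longrightarrow> s < B \<Longrightarrow>
      (\<lambda>n. s ^ n * norm (b ^ n)) \<longlonglongrightarrow> 0 \<Longrightarrow> (\<lambda>n. r ^ n * norm (b ^ n)) \<longlonglongrightarrow> 0"
    using power_decay_step by blast
  have lim: "(\<lambda>n. t ^ n * norm (b ^ n)) \<longlonglongrightarrow> 0" if "0 \<le> t" "t < B" "t \<le> real k * (d / 2)" for k t
    using that
  proof (induction k arbitrary: t)
    \<comment> \<open>Here t = 0. The term for n = 0 is the norm of 1, so the sequence vanishes only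
      from n = 1 on.\<close>
    case 0
    then show ?case
      by (intro tendsto_eventually eventually_mono[OF eventually_gt_at_top[of 0]]) auto
  next
    case (Suc k)
    show ?case
    proof (rule step)
      \<comment> \<open>Going back by half of \<open>d\<close> keeps the inequality t < s + d
        strict; \<open>max\<close> keeps the radius nonnegative.\<close>
      show "(\<lambda>n. max 0 (t - d / 2) ^ n * norm (b ^ n)) \<longlonglongrightarrow> 0"
        using Suc.prems d by (intro Suc.IH) (auto simp: max_def field_simps)
    qed (use Suc.prems d \<open>B > 0\<close> in auto)
  qed
  obtain k where "r / (d / 2) \<le> real k"
    using real_arch_simple by blast
  then show ?thesis
    using assms d by (intro lim[of r k]) (auto simp: B_def field_simps)
qed

end

section \<open>Spectral values in a corner\<close>

text \<open>A product relation in the form that rewrites inside right-associated products, where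
  \<open>a * b\<close> is not a subterm.\<close>

lemma mult_eq_assoc: "a * b = c \<Longrightarrow> a * (b * w) = c * w" for a b c w :: "'a::semigroup_mult"
  by (simp flip: mult.assoc)

text \<open>Invertibility in the corner eAe, whose unit is \<open>e\<close>; the inverse must lie in
  the corner. Stated inside A, it needs no separate type for the corner, and \<open>e = 1\<close>
  gives ordinary invertibility.\<close>

definition invertible_in :: "'a::complex_banach_algebra_1 \<Rightarrow> 'a \<Rightarrow> bool" where
  "invertible_in e x \<longleftrightarrow> (\<exists>y. e * y = y \<and> y * e = y \<and> y * x = e \<and> x * y = e)"

lemma mem_spectrum_iff: "c \<in> spectrum x \<longleftrightarrow> \<not> invertible_in 1 (c *\<^sub>C 1 - x)"
  by (simp add: spectrum_def invertible_in_def)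

lemma invertible_in_scaleC:
  assumes "c \<noteq> 0"
  shows "invertible_in e (c *\<^sub>C x) \<longleftrightarrow> invertible_in e x"
proof -
  have *: "invertible_in e (d *\<^sub>C x)" if inv: "invertible_in e x" and d: "d \<noteq> 0" for d and x :: 'a
  proof -
    obtain y where "e * y = y" "y * e = y" "y * x = e" "x * y = e"
      using inv by (auto simp: invertible_in_def)
    then show ?thesis
      unfolding invertible_in_def using d
      by (intro exI[of _ "inverse d *\<^sub>C y"])
        (simp add: mult_scaleC_left mult_scaleC_right scaleC_scaleC scaleC_one)
  qed
  show ?thesis
    using *[of x c] *[of "c *\<^sub>C x" "inverse c"] assms by (auto simp: scaleC_scaleC scaleC_one)
qed

text \<open>Jacobson's lemma. The inverse 1 + v y u is read off from the formal series 1 + v u + v u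
  v u + ... = 1 + v (1 + u v + ...) u.\<close>

lemma invertible_in_one_minus_swap:
  fixes u v :: "'a::complex_banach_algebra_1"
  assumes "invertible_in 1 (1 - u * v)"
  shows "invertible_in 1 (1 - v * u)"
proof -
  obtain y where y: "y * (1 - u * v) = 1" "(1 - u * v) * y = 1"
    using assms by (auto simp: invertible_in_def)
  have y1: "y * (u * v) = y - 1" and y2: "u * v * y = y - 1"
    using y by (simp_all add: algebra_simps)
  have "(1 + v * y * u) * (1 - v * u) = 1 + v * y * u - v * u - v * (y * (u * v)) * u"
    by (simp add: algebra_simps)
  also have "\<dots> = 1"
    unfolding y1 by (simp add: algebra_simps)
  finally have 1: "(1 + v * y * u) * (1 - v * u) = 1" .
  have "(1 - v * u) * (1 + v * y * u) = 1 + v * y * u - v * u - v * (u * v * y) * u"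
    by (simp add: algebra_simps)
  also have "\<dots> = 1"
    unfolding y2 by (simp add: algebra_simps)
  finally have "(1 - v * u) * (1 + v * y * u) = 1" .
  with 1 show ?thesis
    unfolding invertible_in_def by (intro exI[of _ "1 + v * y * u"]) simp
qed

lemma invertible_in_one_if_nilpotent:
  fixes x :: "'a::complex_banach_algebra_1"
  assumes "x * x = 0"
  shows "invertible_in 1 (1 - x)"
  unfolding invertible_in_def
  by (intro exI[of _ "1 + x"]) (simp add: algebra_simps assms)

section \<open>Quasi-regularity and the Jacobson radical\<close>

lemma left_idealI:
  assumes "0 \<in> L" "\<And>x y. x \<in> L \<Longrightarrow> y \<in> L \<Longrightarrow> x + y \<in> L" "\<And>a x. x \<in> L \<Longrightarrow> a * x \<in> L"
  shows "left_ideal L"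
  unfolding left_ideal_def complex_vector.subspace_def
proof (intro conjI allI ballI)
  fix c x assume "x \<in> L"
  then have "(c *\<^sub>C 1) * x \<in> L" by (rule assms(3))
  then show "c *\<^sub>C x \<in> L" by (simp add: mult_scaleC_left)
qed (use assms in auto)

text \<open>If x lay outside a maximal left ideal L, then L + Ax would be all of A, so 1 - a x would
  lie in L for some a; being invertible, it would force L to be A.\<close>

lemma eq_zero_if_quasi_regular:
  fixes x :: "'a::complex_banach_algebra_1"
  assumes "semisimple TYPE('a)" and inv: "\<And>a. invertible_in 1 (1 - a * x)"
  shows "x = 0"
proof -
  have "x \<in> L" if L: "maximal_left_ideal L" for L
  proof (rule ccontr)
    assume "x \<notin> L"
    have id: "left_ideal L" and "L \<noteq> UNIV"
      and max: "\<And>M. left_ideal M \<Longrightarrow> L \<subseteq> M \<Longrightarrow> M = L \<or> M = UNIV"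
      using L by (auto simp: maximal_left_ideal_def)
    have L0: "0 \<in> L" and Ladd: "\<And>x y. x \<in> L \<Longrightarrow> y \<in> L \<Longrightarrow> x + y \<in> L"
      and Lmult: "\<And>a x. x \<in> L \<Longrightarrow> a * x \<in> L"
      using id by (auto simp: left_ideal_def complex_vector.subspace_def)
    define M where "M = {l + a * x | l a. l \<in> L}"
    have "left_ideal M"
    proof (rule left_idealI)
      show "0 \<in> M" unfolding M_def using L0 by (auto intro!: exI[of _ 0])
    next
      fix u v assume "u \<in> M" "v \<in> M"
      then obtain l a l' a' where "l \<in> L" "l' \<in> L" "u = l + a * x" "v = l' + a' * x"
        by (auto simp: M_def)
      then show "u + v \<in> M"
        unfolding M_def mem_Collect_eq using Ladd
        by (intro exI[of _ "l + l'"] exI[of _ "a + a'"]) (simp add: algebra_simps)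
    next
      fix c u assume "u \<in> M"
      then obtain l a where "l \<in> L" "u = l + a * x"
        by (auto simp: M_def)
      then show "c * u \<in> M"
        unfolding M_def mem_Collect_eq using Lmult
        by (intro exI[of _ "c * l"] exI[of _ "c * a"]) (simp add: algebra_simps)
    qed
    moreover have "L \<subseteq> M"
    proof
      fix l assume "l \<in> L"
      then show "l \<in> M"
        unfolding M_def mem_Collect_eq by (intro exI[of _ l] exI[of _ 0]) simp
    qed
    moreover have "x \<in> M"
      unfolding M_def mem_Collect_eq using L0 by (intro exI[of _ 0] exI[of _ 1]) simp
    ultimately have "M = UNIV" using max \<open>x \<notin> L\<close> by blast
    then obtain l a where l: "l \<in> L" "1 = l + a * x"
      unfolding M_def by blast
    obtain y where "y * (1 - a * x) = 1"
      using inv[of a] by (auto simp: invertible_in_def)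
    moreover have "1 - a * x = l" using l(2) by (simp add: algebra_simps)
    ultimately have "1 \<in> L" using Lmult[OF l(1), of y] by simp
    then have "L = UNIV" using Lmult[of 1] by auto
    with \<open>L \<noteq> UNIV\<close> show False ..
  qed
  then show ?thesis
    using assms(1) by (auto simp: semisimple_def jacobson_radical_def)
qed

lemma eq_zero_if_square_zero_left:
  fixes x :: "'a::complex_banach_algebra_1"
  assumes "semisimple TYPE('a)" and "\<And>a. a * x * (a * x) = 0"
  shows "x = 0"
  using assms invertible_in_one_if_nilpotent by (intro eq_zero_if_quasi_regular) blast+

text \<open>The element c - b splits as (c p - b) + c (1 - p) along p and 1 - p, and the second
  block is invertible since c is nonzero.\<close>

lemma invertible_in_corner_iff:
  fixes p b :: "'a::complex_banach_algebra_1"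
  assumes p: "p * p = p" and b: "p * b = b" "b * p = b" and c: "c \<noteq> 0"
  shows "invertible_in p (c *\<^sub>C p - b) \<longleftrightarrow> c \<notin> spectrum b"
proof
  assume "invertible_in p (c *\<^sub>C p - b)"
  then obtain y where y: "p * y = y" "y * p = y" "y * (c *\<^sub>C p - b) = p" "(c *\<^sub>C p - b) * y = p"
    by (auto simp: invertible_in_def)
  have yb: "c *\<^sub>C y = p + y * b" "c *\<^sub>C y = p + b * y"
    using y by (simp_all add: algebra_simps mult_scaleC_left mult_scaleC_right)
  let ?z = "y + inverse c *\<^sub>C (1 - p)"
  have "?z * (c *\<^sub>C 1 - b) = c *\<^sub>C y - y * b + (1 - p)"
    using c by (simp add: algebra_simps mult_scaleC_left mult_scaleC_right scaleC_scaleC scaleC_one b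
        complex_vector.scale_right_diff_distrib)
  moreover have "(c *\<^sub>C 1 - b) * ?z = c *\<^sub>C y - b * y + (1 - p)"
    using c by (simp add: algebra_simps mult_scaleC_left mult_scaleC_right scaleC_scaleC scaleC_one b
        complex_vector.scale_right_diff_distrib)
  ultimately have "?z * (c *\<^sub>C 1 - b) = 1" "(c *\<^sub>C 1 - b) * ?z = 1"
    using yb by simp_all
  then have "invertible_in 1 (c *\<^sub>C 1 - b)"
    unfolding invertible_in_def by (intro exI[of _ ?z]) simp
  then show "c \<notin> spectrum b"
    by (simp add: mem_spectrum_iff)
next
  assume "c \<notin> spectrum b"
  then obtain y where y: "y * (c *\<^sub>C 1 - b) = 1" "(c *\<^sub>C 1 - b) * y = 1"
    by (auto simp: mem_spectrum_iff invertible_in_def)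
  have cp: "(c *\<^sub>C 1 - b) * p = c *\<^sub>C p - b" "p * (c *\<^sub>C 1 - b) = c *\<^sub>C p - b"
    by (simp_all add: algebra_simps mult_scaleC_left mult_scaleC_right b)
  \<comment> \<open>The projection commutes with c - b and therefore with its inverse.\<close>
  have yp: "p * y = y * p"
  proof -
    have "p * y = y * (c *\<^sub>C 1 - b) * (p * y)" by (simp add: y)
    also have "\<dots> = y * (p * ((c *\<^sub>C 1 - b) * y))"
      by (metis cp mult.assoc)
    finally show ?thesis by (simp add: y)
  qed
  have "y * p * (c *\<^sub>C p - b) = p"
    by (metis cp y(1) mult.assoc mult_1_left yp p)
  moreover have "(c *\<^sub>C p - b) * (y * p) = p"
    by (metis cp y(2) mult.assoc mult_1_left yp p)
  moreover have "p * (y * p) = y * p" "y * p * p = y * p"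
    by (metis yp p mult.assoc)+
  ultimately show "invertible_in p (c *\<^sub>C p - b)"
    unfolding invertible_in_def by (intro exI[of _ "y * p"]) simp
qed

text \<open>An inverse y in the corner would give
  \<open>norm p \<le> norm p * (norm y ^ n * norm (b ^ n))\<close> for all n > 0, and
  \<open>power_decay\<close> at radius \<open>norm y\<close> sends the right side to 0. The
  hypothesis covers an empty spectrum.\<close>

lemma not_invertible_in_corner_if_quasinilpotent:
  fixes p b :: "'a::complex_banach_algebra_1"
  assumes p: "p * p = p" "p \<noteq> 0" and b: "p * b = b" "b * p = b" and sp: "spectrum b \<subseteq> {0}"
  shows "\<not> invertible_in p b"
proof
  assume "invertible_in p b"
  then obtain y where y: "p * y = y" "y * p = y" "y * b = p" "b * y = p"
    by (auto simp: invertible_in_def)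
  have "invertible_in 1 (1 - z *\<^sub>C b)" for z
  proof (cases "z = 0")
    case True
    then show ?thesis by (auto simp: invertible_in_def)
  next
    case False
    then have "invertible_in 1 (inverse z *\<^sub>C 1 - b)"
      using sp mem_spectrum_iff[of "inverse z" b] by auto
    then have "invertible_in 1 (z *\<^sub>C (inverse z *\<^sub>C 1 - b))"
      using False by (simp add: invertible_in_scaleC)
    then show ?thesis
      using False by (simp add: complex_vector.scale_right_diff_distrib scaleC_scaleC scaleC_one)
  qed
  then obtain R where "\<And>z. R z * (1 - z *\<^sub>C b) = 1" "\<And>z. (1 - z *\<^sub>C b) * R z = 1"
    unfolding invertible_in_def by metis
  then have lim: "(\<lambda>n. norm y ^ n * norm (b ^ n)) \<longlonglongrightarrow> 0"
    by (rule power_decay) simp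
  \<comment> \<open>The factor p on the left makes the identity true at n = 0 as well, where b^0 = 1
    may differ from p.\<close>
  have pow: "p * (b ^ n * y ^ n) = p" for n
  proof (induction n)
    case (Suc n)
    have "p * (b ^ Suc n * y ^ Suc n) = p * (b ^ n * (b * y) * y ^ n)"
      by (simp only: power_Suc2[of b] power_Suc[of y] mult.assoc)
    also have "\<dots> = p * (b ^ n * y ^ n)"
    proof (cases n)
      case (Suc m)
      then show ?thesis by (simp add: y mult.assoc mult_eq_assoc[OF y(1)])
    qed (simp add: y p)
    finally show ?case using Suc by simp
  qed (simp add: p)
  \<comment> \<open>The case n = 0 is left out because the norm of 1 may exceed 1.\<close>
  have norm_y_power: "norm (y ^ n) \<le> norm y ^ n" if "n > 0" for n
    using that
  proof (induction n rule: nat_induct_non_zero)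
    case (Suc n)
    have "norm (y ^ Suc n) \<le> norm y * norm (y ^ n)"
      by (simp add: norm_mult_ineq)
    also have "\<dots> \<le> norm y * norm y ^ n"
      by (intro mult_left_mono Suc.IH) auto
    finally show ?case by simp
  qed simp
  have "norm p \<le> norm p * (norm y ^ n * norm (b ^ n))" if "n > 0" for n
  proof -
    have "norm p \<le> norm p * norm (b ^ n * y ^ n)"
      by (metis pow norm_mult_ineq)
    also have "\<dots> \<le> norm p * (norm (b ^ n) * norm (y ^ n))"
      by (intro mult_left_mono norm_mult_ineq) auto
    also have "\<dots> \<le> norm p * (norm (b ^ n) * norm y ^ n)"
      using that norm_y_power by (intro mult_left_mono) auto
    finally show ?thesis by (simp add: mult_ac)
  qed
  then have "eventually (\<lambda>n. norm p \<le> norm p * (norm y ^ n * norm (b ^ n))) sequentially"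
    by (auto intro: eventually_mono[OF eventually_gt_at_top[of 0]])
  moreover have "(\<lambda>n. norm p * (norm y ^ n * norm (b ^ n))) \<longlonglongrightarrow> 0"
    using tendsto_mult_right_zero[OF lim] .
  ultimately have "norm p \<le> 0"
    by (intro tendsto_lowerbound[where F = sequentially]) auto
  with p show False by simp
qed

lemma rank_le_one_spectrum_unique:
  assumes "elem_rank p \<le> 1" "c \<in> spectrum (x * p)" "c \<noteq> 0" "d \<in> spectrum (x * p)" "d \<noteq> 0"
  shows "c = d"
proof -
  let ?S = "spectrum (x * p) - {0}"
  have "ecard ?S \<le> elem_rank p"
    unfolding elem_rank_def by (intro SUP_upper) auto
  with assms(1) have "ecard ?S \<le> 1" by simp
  then have "finite ?S" "card ?S \<le> Suc 0"
    by (auto simp: ecard_def one_enat_def split: if_splits)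
  moreover have "c \<in> ?S" "d \<in> ?S" using assms by auto
  ultimately show ?thesis by (simp only: card_le_Suc0_iff_eq)
qed

text \<open>
  A non-invertible element \<open>q\<close> of the corner \<open>pAp\<close> is quasi-regular in \<open>A\<close>: otherwise some
  \<open>w = pxpq\<close> has spectral value 1, and if \<open>w\<close> were not invertible in the corner, then
  \<open>w + p\<close> would have the two nonzero spectral values 1 and 2.
\<close>

lemma corner_quasi_regular:
  fixes p q :: "'a::complex_banach_algebra_1"
  assumes p: "p * p = p" and rank: "elem_rank p \<le> 1" and q: "p * q = q" "q * p = q"
    and ninv: "\<not> invertible_in p q"
  shows "invertible_in 1 (1 - x * q)"
proof (rule ccontr)
  assume contra: "\<not> invertible_in 1 (1 - x * q)"
  define y where "y = p * x * p"
  have y: "p * y = y" "y * p = y"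
    by (simp_all add: y_def mult.assoc p mult_eq_assoc[OF p])
  have inv: "invertible_in p w" if w: "p * w = w" "w * p = w" "1 \<in> spectrum w" for w
  proof (rule ccontr)
    assume "\<not> invertible_in p w"
    then have "\<not> invertible_in p ((-1) *\<^sub>C w)" by (subst invertible_in_scaleC) auto
    then have 1: "\<not> invertible_in p (1 *\<^sub>C p - (w + p))"
      by (simp add: scaleC_one complex_vector.scale_minus_left)
    have "\<not> invertible_in p (1 *\<^sub>C p - w)"
      using w invertible_in_corner_iff[of p w 1] p by simp
    then have 2: "\<not> invertible_in p (2 *\<^sub>C p - (w + p))"
      using scaleC_add_left[of 1 1 p] by (simp add: scaleC_one algebra_simps)
    have wp: "p * (w + p) = w + p" "(w + p) * p = w + p"
      using w p by (simp_all add: algebra_simps)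
    have "1 \<in> spectrum ((w + p) * p)" "2 \<in> spectrum ((w + p) * p)"
      unfolding wp using 1 2 invertible_in_corner_iff[OF p wp, of 1]
        invertible_in_corner_iff[OF p wp, of 2] zero_neq_one zero_neq_numeral by metis+
    then show False
      using rank_le_one_spectrum_unique[OF rank, of 1 "w + p" 2] by simp
  qed
  have s: "1 \<in> spectrum w \<longleftrightarrow> \<not> invertible_in 1 (1 - w)" for w :: 'a
    by (simp add: mem_spectrum_iff scaleC_one)
  have "\<not> invertible_in 1 (1 - y * q)"
  proof
    assume "invertible_in 1 (1 - y * q)"
    moreover have "y * q = p * (x * q)"
      by (simp add: y_def mult.assoc q)
    \<comment> \<open>Jacobson's lemma moves p to the right of x q, where it is absorbed because q p
      = q.\<close>
    ultimately have "invertible_in 1 (1 - x * q * p)"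
      by (metis invertible_in_one_minus_swap)
    with contra show False by (simp add: mult.assoc q)
  qed
  moreover from this have "\<not> invertible_in 1 (1 - q * y)"
    using invertible_in_one_minus_swap by blast
  ultimately have "invertible_in p (y * q)" "invertible_in p (q * y)"
    by (intro inv; simp add: s mult.assoc q y mult_eq_assoc[OF q(1)] mult_eq_assoc[OF y(1)])+
  then obtain u v where u: "p * u = u" "u * p = u" "u * (y * q) = p"
    and v: "p * v = v" "v * p = v" "q * y * v = p"
    unfolding invertible_in_def by blast
  \<comment> \<open>In the corner \<open>u * y\<close> is a left inverse and \<open>y * v\<close> a
    right inverse of q, so the two coincide. This is why both y q and q y were shown to be
    invertible.\<close>
  have "u * y = u * y * (q * (y * v))"
    using v(3) y by (simp add: mult.assoc)
  also have "\<dots> = (u * (y * q)) * (y * v)"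
    by (simp only: mult.assoc)
  also have "\<dots> = y * v"
    by (simp add: u(3) mult_eq_assoc[OF y(1)])
  finally have "u * y = y * v" .
  then have "y * v * q = p"
    using u(3) by (metis mult.assoc)
  then have "invertible_in p q"
    unfolding invertible_in_def using v
    by (intro exI[of _ "y * v"]) (simp add: mult.assoc mult_eq_assoc[OF y(1)])
  with ninv show False ..
qed

lemma corner_scalar:
  fixes p :: "'a::complex_banach_algebra_1"
  assumes ss: "semisimple TYPE('a)" and p: "projection p" and rank: "elem_rank p \<le> 1"
  obtains c where "p * a * p = c *\<^sub>C p"
proof (cases "p = 0")
  case True
  then show ?thesis using that[of 0] by simp
next
  case False
  have pp: "p * p = p" using p by (simp add: projection_def)
  define b where "b = p * a * p"
  have b: "p * b = b" "b * p = b"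
    by (simp_all add: b_def mult.assoc pp mult_eq_assoc[OF pp])
  \<comment> \<open>The value 0 in \<open>spectrum b\<close> says nothing about the corner, since b
    is singular in A whenever p differs from 1; hence the case split.\<close>
  obtain c where c: "\<not> invertible_in p (b - c *\<^sub>C p)"
  proof (cases "spectrum b \<subseteq> {0}")
    case True
    then have "\<not> invertible_in p b"
      using not_invertible_in_corner_if_quasinilpotent[of p b] pp False b by simp
    then show ?thesis using that[of 0] by simp
  next
    case False
    then obtain c where "c \<in> spectrum b" "c \<noteq> 0" by auto
    then have "\<not> invertible_in p (c *\<^sub>C p - b)"
      using invertible_in_corner_iff[OF pp b] by blast
    moreover have "c *\<^sub>C p - b = (-1) *\<^sub>C (b - c *\<^sub>C p)"
      by (simp add: complex_vector.scale_minus_left scaleC_one)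
    ultimately have "\<not> invertible_in p (b - c *\<^sub>C p)"
      by (metis invertible_in_scaleC neg_equal_0_iff_equal one_neq_zero)
    then show ?thesis by (rule that)
  qed
  have q: "p * (b - c *\<^sub>C p) = b - c *\<^sub>C p" "(b - c *\<^sub>C p) * p = b - c *\<^sub>C p"
    by (simp_all add: algebra_simps b pp mult_scaleC_left mult_scaleC_right)
  have "b - c *\<^sub>C p = 0"
    by (intro eq_zero_if_quasi_regular[OF ss] corner_quasi_regular[OF pp rank q c])
  then show ?thesis using that[of c] by (simp add: b_def)
qed

section \<open>Minimal left ideals and the socle\<close>

text \<open>The case \<open>p = 0\<close> is admitted, since rank zero is allowed.\<close>

definition minimal_projection :: "'a::complex_banach_algebra_1 \<Rightarrow> bool" where
  "minimal_projection p \<longleftrightarrow> p * p = p \<and> (\<forall>a. \<exists>c. p * a * p = c *\<^sub>C p)"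

lemma minimal_projection_if_rank_le_one:
  fixes p :: "'a::complex_banach_algebra_1"
  assumes "semisimple TYPE('a)" "projection p" "elem_rank p \<le> 1"
  shows "minimal_projection p"
  using corner_scalar[OF assms] assms(2) by (metis minimal_projection_def projection_def)

text \<open>By semisimplicity some a x p has nonzero square. That square contains the factor p a x p
  = c p, so c is nonzero and can be divided out.\<close>

lemma minimal_projection_recover:
  fixes p x :: "'a::complex_banach_algebra_1"
  assumes ss: "semisimple TYPE('a)" and p: "minimal_projection p" and x: "x * p \<noteq> 0"
  obtains a where "p * a * x * p = p"
proof -
  obtain a where a: "a * (x * p) * (a * (x * p)) \<noteq> 0"
    using eq_zero_if_square_zero_left[OF ss] x by blast
  obtain c where c: "p * (a * x) * p = c *\<^sub>C p"
    using p unfolding minimal_projection_def by blast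
  have "c \<noteq> 0"
  proof
    assume "c = 0"
    have "a * (x * p) * (a * (x * p)) = a * x * (p * (a * x) * p)"
      by (simp only: mult.assoc)
    with a c \<open>c = 0\<close> show False by simp
  qed
  then have "p * (inverse c *\<^sub>C a) * x * p = p"
    using c by (simp add: mult_scaleC_left mult_scaleC_right scaleC_scaleC scaleC_one mult.assoc)
  then show ?thesis by (rule that)
qed

section \<open>The two-sided ideals \<open>J p\<close>\<close>

lemma J_zero: "0 \<in> J p"
  unfolding J_def mem_Collect_eq by (intro exI[of _ 1] exI[of _ "\<lambda>_. 0"]) simp

lemma J_generator: "x * p * y \<in> J p"
  unfolding J_def mem_Collect_eq
  by (intro exI[of _ "1 :: nat"] exI[of _ "\<lambda>_. x"] exI[of _ "\<lambda>_. y"]) simp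

lemma J_add:
  assumes "a \<in> J p" "b \<in> J p"
  shows "a + b \<in> J p"
proof -
  obtain n x y where 1: "n \<ge> (1::nat)" "a = (\<Sum>j<n. x j * p * y j)"
    using assms(1) by (auto simp: J_def)
  obtain m :: nat and x' y' where 2: "b = (\<Sum>j<m. x' j * p * y' j)"
    using assms(2) by (auto simp: J_def)
  let ?x = "\<lambda>j. if j < n then x j else x' (j - n)" and ?y = "\<lambda>j. if j < n then y j else y' (j - n)"
  have "(\<Sum>j<n + k. ?x j * p * ?y j) = a + (\<Sum>j<k. x' j * p * y' j)" for k
    by (induction k) (simp_all add: 1 add.assoc)
  then have "a + b = (\<Sum>j<n + m. ?x j * p * ?y j)"
    by (simp add: 2)
  with 1(1) show ?thesis
    unfolding J_def mem_Collect_eq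
    by (intro exI[of _ "n + m"] exI[of _ ?x] exI[of _ ?y]) simp
qed

lemma J_sum: "(\<And>i. i \<in> F \<Longrightarrow> f i \<in> J p) \<Longrightarrow> sum f F \<in> J p"
  by (induction F rule: infinite_finite_induct) (auto simp: J_zero J_add)

lemma J_mult_left:
  assumes "b \<in> J p"
  shows "a * b \<in> J p"
proof -
  obtain n :: nat and x y where "b = (\<Sum>j<n. x j * p * y j)"
    using assms by (auto simp: J_def)
  then have "a * b = (\<Sum>j<n. (a * x j) * p * y j)"
    by (simp add: sum_distrib_left mult.assoc)
  then show ?thesis by (simp add: J_sum J_generator)
qed

lemma J_mult_right:
  assumes "b \<in> J p"
  shows "b * a \<in> J p"
proof -
  obtain n :: nat and x y where "b = (\<Sum>j<n. x j * p * y j)"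
    using assms by (auto simp: J_def)
  then have "b * a = (\<Sum>j<n. x j * p * (y j * a))"
    by (simp add: sum_distrib_right mult.assoc)
  then show ?thesis by (simp only: J_sum J_generator)
qed

lemma J_scale: "b \<in> J p \<Longrightarrow> c *\<^sub>C b \<in> J p"
  using J_mult_left[of b p "c *\<^sub>C 1"] by (simp add: mult_scaleC_left)

lemma J_diff: "a \<in> J p \<Longrightarrow> b \<in> J p \<Longrightarrow> a - b \<in> J p"
  using J_add[of a p "(-1) *\<^sub>C b"] J_scale[of b p "-1"]
  by (simp add: complex_vector.scale_minus_left scaleC_one)

text \<open>A nonzero b p y in a smaller left ideal M generates everything: b p is nonzero, and p a
  b p = p puts c p y = (c p a)(b p y) into M for every c.\<close>

lemma minimal_left_ideal_principal:
  fixes p y :: "'a::complex_banach_algebra_1"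
  assumes ss: "semisimple TYPE('a)" and p: "minimal_projection p" and y: "p * y \<noteq> 0"
  shows "minimal_left_ideal (range (\<lambda>a. a * p * y))"
  unfolding minimal_left_ideal_def
proof (intro conjI allI impI)
  show "left_ideal (range (\<lambda>a. a * p * y))"
  proof (rule left_idealI)
    show "0 \<in> range (\<lambda>a. a * p * y)" by (rule range_eqI[of _ _ 0]) simp
  next
    fix u v assume "u \<in> range (\<lambda>a. a * p * y)" "v \<in> range (\<lambda>a. a * p * y)"
    then obtain a b where "u = a * p * y" "v = b * p * y" by blast
    then show "u + v \<in> range (\<lambda>a. a * p * y)"
      by (intro range_eqI[of _ _ "a + b"]) (simp add: distrib_right)
  next
    fix c u assume "u \<in> range (\<lambda>a. a * p * y)"
    then obtain a where "u = a * p * y" by blast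
    then show "c * u \<in> range (\<lambda>a. a * p * y)"
      by (intro range_eqI[of _ _ "c * a"]) (simp add: mult.assoc)
  qed
  show "range (\<lambda>a. a * p * y) \<noteq> {0}"
    using y by (metis mult_1_left range_eqI singletonD)
next
  fix M assume M: "left_ideal M" "M \<subseteq> range (\<lambda>a. a * p * y)"
  have M0: "0 \<in> M" and Mmult: "\<And>a x. x \<in> M \<Longrightarrow> a * x \<in> M"
    using M(1) by (auto simp: left_ideal_def complex_vector.subspace_def)
  show "M = {0} \<or> M = range (\<lambda>a. a * p * y)"
  proof (rule disjCI)
    assume "M \<noteq> range (\<lambda>a. a * p * y)"
    have "x = 0" if x: "x \<in> M" for x
    proof (rule ccontr)
      assume "x \<noteq> 0"
      obtain b where b: "x = b * p * y" using M(2) x by blast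
      with \<open>x \<noteq> 0\<close> have "b * p \<noteq> 0" by auto
      then obtain a where a: "p * a * b * p = p"
        by (rule minimal_projection_recover[OF ss p])
      have "c * p * y \<in> M" for c
      proof -
        have "c * p * y = c * (p * a * b * p) * y" by (simp only: a)
        also have "\<dots> = c * p * a * x" by (simp only: b mult.assoc)
        finally show ?thesis using Mmult[OF x] by simp
      qed
      with M(2) \<open>M \<noteq> range (\<lambda>a. a * p * y)\<close> show False by blast
    qed
    with M0 show "M = {0}" by blast
  qed
qed

section \<open>Sums in the socle\<close>

lemma Soc_zero: "0 \<in> Soc"
  unfolding Soc_def mem_Collect_eq by (intro exI[of _ "{}"]) simp

lemma Soc_add:
  assumes "a \<in> Soc" "b \<in> Soc"
  shows "a + b \<in> Soc"
proof -
  obtain F f where F: "finite F" "\<And>L. L \<in> F \<Longrightarrow> minimal_left_ideal L \<and> f L \<in> L" "a = sum f F"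
    using assms(1) by (auto simp: Soc_def)
  obtain G g where G: "finite G" "\<And>L. L \<in> G \<Longrightarrow> minimal_left_ideal L \<and> g L \<in> L" "b = sum g G"
    using assms(2) by (auto simp: Soc_def)
  \<comment> \<open>The definition of \<open>Soc\<close> allows one summand per ideal, so an ideal
    occurring in both representations receives both contributions.\<close>
  let ?h = "\<lambda>L. (if L \<in> F then f L else 0) + (if L \<in> G then g L else 0)"
  have "(\<Sum>L\<in>F \<union> G. if L \<in> F then f L else 0) = sum f F"
    "(\<Sum>L\<in>F \<union> G. if L \<in> G then g L else 0) = sum g G"
    using F(1) G(1) by (auto intro!: sum.mono_neutral_cong_right)
  then have "a + b = (\<Sum>L\<in>F \<union> G. ?h L)"
    by (simp add: sum.distrib F G)
  moreover have "minimal_left_ideal L \<and> ?h L \<in> L" if "L \<in> F \<union> G" for L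
  proof -
    have L: "minimal_left_ideal L" using that F G by blast
    then have "complex_vector.subspace L"
      by (simp add: minimal_left_ideal_def left_ideal_def)
    with L that F(2) G(2) show ?thesis
      by (auto intro: complex_vector.subspace_add)
  qed
  ultimately show ?thesis
    unfolding Soc_def mem_Collect_eq using F(1) G(1)
    by (intro exI[of _ ?h] exI[of _ "F \<union> G"]) blast
qed

lemma Soc_sum: "(\<And>i. i \<in> F \<Longrightarrow> f i \<in> Soc) \<Longrightarrow> sum f F \<in> Soc"
  by (induction F rule: infinite_finite_induct) (auto simp: Soc_zero Soc_add)

lemma J_subset_Soc:
  fixes p :: "'a::complex_banach_algebra_1"
  assumes ss: "semisimple TYPE('a)" and p: "minimal_projection p"
  shows "J p \<subseteq> Soc"
proof -
  have "x * p * y \<in> Soc" for x y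
  proof (cases "p * y = 0")
    case False
    let ?L = "range (\<lambda>a. a * p * y)"
    show ?thesis
      unfolding Soc_def mem_Collect_eq
      using minimal_left_ideal_principal[OF ss p False]
      by (intro exI[of _ "{?L}"] exI[of _ "\<lambda>_. x * p * y"]) auto
  qed (simp add: Soc_zero mult.assoc)
  then show ?thesis by (auto simp: J_def Soc_sum)
qed

lemma orthogonal_sum_eq_zero:
  fixes a :: "'a \<Rightarrow> 'a::complex_banach_algebra_1"
  assumes ss: "semisimple TYPE('a)" and F: "finite F" "\<And>p. p \<in> F \<Longrightarrow> a p \<in> J p"
    and orth: "\<And>p q x y. p \<in> F \<Longrightarrow> q \<in> F \<Longrightarrow> p \<noteq> q \<Longrightarrow> x \<in> J p \<Longrightarrow> y \<in> J q \<Longrightarrow> x * y = 0"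
    and sum: "sum a F = 0" and q: "q \<in> F"
  shows "a q = 0"
proof (rule eq_zero_if_square_zero_left[OF ss])
  fix b
  \<comment> \<open>Multiplication by this element of \<open>J q\<close> removes all other summands
    and leaves the square of \<open>b * a q\<close>.\<close>
  let ?c = "b * a q * b"
  have c: "?c \<in> J q"
    using F(2)[OF q] by (intro J_mult_left J_mult_right)
  have "0 = (\<Sum>p\<in>F. ?c * a p)"
    using sum by (simp flip: sum_distrib_left)
  also have "\<dots> = (\<Sum>p\<in>F. if p = q then ?c * a q else 0)"
    using orth[OF q _ _ c F(2)] by (intro sum.cong) auto
  also have "\<dots> = ?c * a q"
    using F(1) q by simp
  finally show "b * a q * (b * a q) = 0" by (simp add: mult.assoc)
qed

section \<open>Injectivity of \<open>\<phi>\<^sub>p\<close>\<close>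

abbreviation pure :: "'v \<Rightarrow> 'w \<Rightarrow> ('v \<times> 'w \<Rightarrow>\<^sub>0 complex)" where
  "pure x y \<equiv> Poly_Mapping.single (x, y) 1"

abbreviation null :: "'v::complex_vector set \<Rightarrow> 'w::complex_vector set \<Rightarrow> ('v \<times> 'w \<Rightarrow>\<^sub>0 complex) set" where
  "null V W \<equiv> complex_vector.span (bilinear_relators V W)"

lemma pure_add_left:
  "x \<in> V \<Longrightarrow> x' \<in> V \<Longrightarrow> y \<in> W \<Longrightarrow> pure (x + x') y - pure x y - pure x' y \<in> null V W"
  by (rule complex_vector.span_base) (force simp: bilinear_relators_def)

lemma pure_add_right:
  "x \<in> V \<Longrightarrow> y \<in> W \<Longrightarrow> y' \<in> W \<Longrightarrow> pure x (y + y') - pure x y - pure x y' \<in> null V W"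
  by (rule complex_vector.span_base) (force simp: bilinear_relators_def)

lemma pure_scale_left:
  "x \<in> V \<Longrightarrow> y \<in> W \<Longrightarrow> pure (c *\<^sub>C x) y - c *\<^sub>C pure x y \<in> null V W"
  by (rule complex_vector.span_base) (force simp: bilinear_relators_def)

lemma pure_scale_right:
  "x \<in> V \<Longrightarrow> y \<in> W \<Longrightarrow> pure x (c *\<^sub>C y) - c *\<^sub>C pure x y \<in> null V W"
  by (rule complex_vector.span_base) (force simp: bilinear_relators_def)

lemma pure_zero_left: "x \<in> V \<Longrightarrow> y \<in> W \<Longrightarrow> pure 0 y \<in> null V W"
  using pure_scale_left[of x V y W 0] by simp

lemma pure_zero_right: "x \<in> V \<Longrightarrow> y \<in> W \<Longrightarrow> pure x 0 \<in> null V W"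
  using pure_scale_right[of x V y W 0] by simp

lemma pure_linear_combination_right:
  assumes W: "complex_vector.subspace W" and x: "x \<in> V" and y: "\<And>i. i \<in> S \<Longrightarrow> y i \<in> W"
  shows "pure x (\<Sum>i\<in>S. c i *\<^sub>C y i) - (\<Sum>i\<in>S. c i *\<^sub>C pure x (y i)) \<in> null V W"
  using y
proof (induction S rule: infinite_finite_induct)
  case (insert i S)
  let ?t = "\<Sum>i\<in>S. c i *\<^sub>C y i"
  have "c i *\<^sub>C y i \<in> W" "?t \<in> W"
    using W insert.prems
    by (auto intro!: complex_vector.subspace_sum complex_vector.subspace_scale)
  then have "pure x (c i *\<^sub>C y i + ?t) - pure x (c i *\<^sub>C y i) - pure x ?t \<in> null V W"
    using x by (intro pure_add_right)
  moreover have "pure x (c i *\<^sub>C y i) - c i *\<^sub>C pure x (y i) \<in> null V W"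
    using x insert.prems by (intro pure_scale_right) auto
  ultimately have "(pure x (c i *\<^sub>C y i + ?t) - pure x (c i *\<^sub>C y i) - pure x ?t)
      + (pure x (c i *\<^sub>C y i) - c i *\<^sub>C pure x (y i))
      + (pure x ?t - (\<Sum>i\<in>S. c i *\<^sub>C pure x (y i))) \<in> null V W"
    using insert by (intro complex_vector.span_add) auto
  then show ?case
    using insert.hyps by (simp add: algebra_simps)
\<comment> \<open>For an empty or infinite \<open>S\<close> the sum is 0, but in the free space
  \<open>pure x 0\<close> is a null vector and not 0.\<close>
qed (use complex_vector.subspace_0[OF W] x pure_zero_right in auto)

lemma subspace_left_mults: "complex_vector.subspace (left_mults p)"
  unfolding complex_vector.subspace_def left_mults_def
  by (auto simp flip: distrib_right mult_scaleC_left intro: exI[of _ 0])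

lemma subspace_right_mults: "complex_vector.subspace (right_mults p)"
  unfolding complex_vector.subspace_def right_mults_def
  by (auto simp flip: distrib_left mult_scaleC_right intro: exI[of _ 0])

lemma left_mults_absorb: "p * p = p \<Longrightarrow> x \<in> left_mults p \<Longrightarrow> x * p = x"
  by (auto simp: left_mults_def mult.assoc)

lemma right_mults_absorb: "p * p = p \<Longrightarrow> y \<in> right_mults p \<Longrightarrow> p * y = y"
  by (auto simp: right_mults_def simp flip: mult.assoc)

text \<open>
  If \<open>x\<^sub>k \<noteq> 0\<close>, then \<open>p = pax\<^sub>k\<close> for some \<open>a\<close>, so multiplying the relation by \<open>pa\<close> expresses
  \<open>y\<^sub>k\<close> as a linear combination of the other \<open>y\<^sub>j\<close>, which eliminates one summand.
\<close>

lemma sum_pure_in_null: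
  fixes x y :: "'i \<Rightarrow> 'a::complex_banach_algebra_1"
  assumes ss: "semisimple TYPE('a)" and p: "minimal_projection p" and "finite S"
    and "\<And>i. i \<in> S \<Longrightarrow> x i \<in> left_mults p" "\<And>i. i \<in> S \<Longrightarrow> y i \<in> right_mults p"
    and "(\<Sum>i\<in>S. x i * y i) = 0"
  shows "(\<Sum>i\<in>S. pure (x i) (y i)) \<in> null (left_mults p) (right_mults p)"
  using assms(3-)
\<comment> \<open>Elimination changes the left factors, so \<open>x\<close> has to vary; the right
  factors stay fixed.\<close>
proof (induction S arbitrary: x rule: finite_induct)
  case empty
  show ?case by (simp add: complex_vector.span_zero)
next
  case (insert k S)
  let ?V = "left_mults p" and ?W = "right_mults p"
  have pp: "p * p = p" using p by (simp add: minimal_projection_def)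
  have xV: "x k \<in> ?V" "\<And>i. i \<in> S \<Longrightarrow> x i \<in> ?V" and yW: "y k \<in> ?W" "\<And>i. i \<in> S \<Longrightarrow> y i \<in> ?W"
    using insert.prems by auto
  have sum0: "x k * y k = - (\<Sum>i\<in>S. x i * y i)"
    using insert.prems(3) insert.hyps by (simp add: eq_neg_iff_add_eq_0)
  show ?case
  proof (cases "x k = 0")
    case True
    then have "(\<Sum>i\<in>S. pure (x i) (y i)) \<in> null ?V ?W"
      using sum0 xV yW by (intro insert.IH) auto
    moreover have "pure (x k) (y k) \<in> null ?V ?W"
      using pure_zero_left[OF xV(1) yW(1)] True by simp
    ultimately show ?thesis
      using insert.hyps by (simp add: complex_vector.span_add)
  next
    case False
    then have "x k * p \<noteq> 0" using left_mults_absorb[OF pp xV(1)] by simp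
    then obtain a where "p * a * x k * p = p"
      by (rule minimal_projection_recover[OF ss p])
    then have a: "p * a * x k = p"
      using left_mults_absorb[OF pp xV(1)] by (simp add: mult.assoc)
    have "\<exists>c. p * a * x i = c *\<^sub>C p" if "i \<in> S" for i
      using p left_mults_absorb[OF pp xV(2)[OF that]]
      unfolding minimal_projection_def by (metis mult.assoc)
    then obtain c where c: "\<And>i. i \<in> S \<Longrightarrow> p * a * x i = c i *\<^sub>C p" by metis
    let ?m = "\<lambda>i. - c i"
    have "y k = p * a * (x k * y k)"
      using a right_mults_absorb[OF pp yW(1)] by (simp flip: mult.assoc)
    also have "\<dots> = (\<Sum>i\<in>S. - (p * a * x i * y i))"
      by (simp add: sum0 sum_distrib_left sum_negf mult.assoc)
    also have "\<dots> = (\<Sum>i\<in>S. ?m i *\<^sub>C y i)"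
      using right_mults_absorb[OF pp yW(2)]
      by (intro sum.cong) (simp_all add: c mult_scaleC_left complex_vector.scale_minus_left)
    finally have yk: "y k = (\<Sum>i\<in>S. ?m i *\<^sub>C y i)" .
    have mV: "?m i *\<^sub>C x k \<in> ?V" for i
      by (rule complex_vector.subspace_scale[OF subspace_left_mults xV(1)])
    \<comment> \<open>Modulo null vectors, \<open>?A\<close> spreads the k-th summand over the
      others, \<open>?C\<close> moves the scalars into the left factor, and \<open>?B\<close> merges
      the tensors that share a right factor; what remains is \<open>?D\<close>.\<close>
    let ?A = "pure (x k) (y k) - (\<Sum>i\<in>S. ?m i *\<^sub>C pure (x k) (y i))"
    let ?B = "\<lambda>i. pure (x i + ?m i *\<^sub>C x k) (y i) - pure (x i) (y i) - pure (?m i *\<^sub>C x k) (y i)"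
    let ?C = "\<lambda>i. pure (?m i *\<^sub>C x k) (y i) - ?m i *\<^sub>C pure (x k) (y i)"
    let ?D = "\<Sum>i\<in>S. pure (x i + ?m i *\<^sub>C x k) (y i)"
    have A: "?A \<in> null ?V ?W"
      unfolding yk by (rule pure_linear_combination_right[OF subspace_right_mults xV(1) yW(2)])
    have B: "(\<Sum>i\<in>S. ?B i) \<in> null ?V ?W"
      using xV(2) yW(2) mV by (intro complex_vector.span_sum pure_add_left) auto
    have C: "(\<Sum>i\<in>S. ?C i) \<in> null ?V ?W"
      using xV(1) yW(2) by (intro complex_vector.span_sum pure_scale_left) auto
    have D: "?D \<in> null ?V ?W"
    proof (rule insert.IH)
      have "(\<Sum>i\<in>S. (x i + ?m i *\<^sub>C x k) * y i) = (\<Sum>i\<in>S. x i * y i) + x k * (\<Sum>i\<in>S. ?m i *\<^sub>C y i)"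
        by (simp add: distrib_right sum.distrib sum_distrib_left mult_scaleC_left mult_scaleC_right
            del: complex_vector.scale_minus_left)
      then show "(\<Sum>i\<in>S. (x i + ?m i *\<^sub>C x k) * y i) = 0"
        using sum0 by (simp only: flip: yk) simp
    qed (use yW complex_vector.subspace_add[OF subspace_left_mults xV(2) mV] in blast)+
    have "?A + ?D - (\<Sum>i\<in>S. ?B i) - (\<Sum>i\<in>S. ?C i) \<in> null ?V ?W"
      by (rule complex_vector.span_diff[OF complex_vector.span_diff[OF
        complex_vector.span_add[OF A D] B] C])
    also have "?A + ?D - (\<Sum>i\<in>S. ?B i) - (\<Sum>i\<in>S. ?C i) = pure (x k) (y k) + (\<Sum>i\<in>S. pure (x i) (y i))"
      by (simp only: sum_subtractf) (simp del: complex_vector.scale_minus_left)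
    finally show ?thesis using insert.hyps by simp
  qed
qed

lemma sum_scaled_pure: "(\<Sum>k\<in>Poly_Mapping.keys f. Poly_Mapping.lookup f k *\<^sub>C Poly_Mapping.single k 1) = f"
  for f :: "'k \<Rightarrow>\<^sub>0 complex"
proof (rule poly_mapping_eqI)
  fix j
  have "Poly_Mapping.lookup (\<Sum>k\<in>Poly_Mapping.keys f. Poly_Mapping.lookup f k *\<^sub>C Poly_Mapping.single k 1) j
      = (\<Sum>k\<in>Poly_Mapping.keys f. if k = j then Poly_Mapping.lookup f k else 0)"
    unfolding lookup_sum
    by (intro sum.cong) (auto simp: scaleC_poly_mapping_lookup lookup_single when_def scaleC_complex_def)
  then show "Poly_Mapping.lookup (\<Sum>k\<in>Poly_Mapping.keys f. Poly_Mapping.lookup f k *\<^sub>C Poly_Mapping.single k 1) j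
      = Poly_Mapping.lookup f j"
    by (simp add: in_keys_iff)
qed

text \<open>Coefficients are moved into the left factors, since \<open>sum_pure_in_null\<close>
  treats plain sums, and the middle p of \<open>free_phi\<close> is absorbed there too. The scaling
  relators then restore the coefficients.\<close>

lemma free_phi_eq_zero_imp_null:
  fixes p :: "'a::complex_banach_algebra_1"
  assumes ss: "semisimple TYPE('a)" and p: "minimal_projection p"
    and f: "f \<in> free_space (left_mults p) (right_mults p)" and zero: "free_phi p f = 0"
  shows "f \<in> null (left_mults p) (right_mults p)"
proof -
  let ?V = "left_mults p" and ?W = "right_mults p" and ?K = "Poly_Mapping.keys f"
  let ?l = "Poly_Mapping.lookup f"
  have pp: "p * p = p" using p by (simp add: minimal_projection_def)
  have K: "fst k \<in> ?V" "snd k \<in> ?W" if "k \<in> ?K" for k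
    using f that by (auto simp: free_space_def)
  have "(\<Sum>k\<in>?K. (?l k *\<^sub>C fst k) * snd k) = free_phi p f"
    unfolding free_phi_def
    using K left_mults_absorb[OF pp] by (intro sum.cong) (auto simp: mult_scaleC_left)
  then have "(\<Sum>k\<in>?K. pure (?l k *\<^sub>C fst k) (snd k)) \<in> null ?V ?W"
    using zero K(2) complex_vector.subspace_scale[OF subspace_left_mults K(1)]
    by (intro sum_pure_in_null[OF ss p] finite_keys) (assumption | simp only:)+
  moreover have "(\<Sum>k\<in>?K. pure (?l k *\<^sub>C fst k) (snd k) - ?l k *\<^sub>C pure (fst k) (snd k)) \<in> null ?V ?W"
    using K by (intro complex_vector.span_sum pure_scale_left)
  ultimately have "(\<Sum>k\<in>?K. pure (?l k *\<^sub>C fst k) (snd k)) -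
      (\<Sum>k\<in>?K. pure (?l k *\<^sub>C fst k) (snd k) - ?l k *\<^sub>C pure (fst k) (snd k)) \<in> null ?V ?W"
    by (rule complex_vector.span_diff)
  then show ?thesis by (simp add: sum_subtractf sum_scaled_pure)
qed

lemma free_phi_zero: "free_phi p 0 = 0"
  by (simp add: free_phi_def)

lemma bij_betw_phi:
  fixes p :: "'a::complex_banach_algebra_1"
  assumes ss: "semisimple TYPE('a)" and p: "minimal_projection p"
  shows "bij_betw (phi p) (tensor_space (left_mults p) (right_mults p)) (J p)"
proof -
  let ?V = "left_mults p" and ?W = "right_mults p"
  have pp: "p * p = p" using p by (simp add: minimal_projection_def)
  have "inj_on (phi p) (tensor_space ?V ?W)"
  proof (rule inj_onI)
    fix s t assume "s \<in> tensor_space ?V ?W" "t \<in> tensor_space ?V ?W" and eq: "phi p s = phi p t"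
    then obtain f g where f: "f \<in> free_space ?V ?W" "s = tensor_rel ?V ?W `` {f}"
      and g: "g \<in> free_space ?V ?W" "t = tensor_rel ?V ?W `` {g}"
      unfolding tensor_space_def by (meson quotientE)
    have "free_phi p (f - g) = 0"
      using eq by (simp add: f(2) g(2) phi_class[OF f(1)] phi_class[OF g(1)] free_phi_diff)
    moreover have "f - g \<in> free_space ?V ?W"
      using f(1) g(1) by (rule complex_vector.subspace_diff[OF subspace_free_space])
    ultimately have "(f, g) \<in> tensor_rel ?V ?W"
      using f g free_phi_eq_zero_imp_null[OF ss p] by (auto simp: tensor_rel_def)
    then show "s = t"
      unfolding f(2) g(2) by (rule equiv_class_eq[OF equiv_tensor_rel])
  qed
  moreover have "phi p ` tensor_space ?V ?W = J p"
  proof (intro equalityI subsetI)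
    fix a assume "a \<in> phi p ` tensor_space ?V ?W"
    then obtain f where "f \<in> free_space ?V ?W" "a = free_phi p f"
      unfolding tensor_space_def by (auto elim!: quotientE simp: phi_class)
    then show "a \<in> J p"
      by (auto simp: free_phi_def intro!: J_sum J_scale J_generator)
  next
    fix a assume "a \<in> J p"
    then obtain n :: nat and x y where a: "a = (\<Sum>j<n. x j * p * y j)"
      by (auto simp: J_def)
    have "\<exists>f\<in>free_space ?V ?W. free_phi p f = (\<Sum>j<n. x j * p * y j)"
    proof (induction n)
      case 0
      show ?case
        using complex_vector.subspace_0[OF subspace_free_space, of ?V ?W]
        by (intro bexI[of _ 0]) (simp_all add: free_phi_zero)
    next
      case (Suc n)
      then obtain f where f: "f \<in> free_space ?V ?W" "free_phi p f = (\<Sum>j<n. x j * p * y j)"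
        by blast
      \<comment> \<open>As p is idempotent, x p y = (x p) p (p y), so every generator of
        \<open>J p\<close> comes from a tensor with factors in Ap and pA.\<close>
      have "pure (x n * p) (p * y n) \<in> free_space ?V ?W"
        by (auto simp: free_space_def left_mults_def right_mults_def)
      with f(1) have "f + pure (x n * p) (p * y n) \<in> free_space ?V ?W"
        by (rule complex_vector.subspace_add[OF subspace_free_space])
      moreover have "free_phi p (f + pure (x n * p) (p * y n)) = (\<Sum>j<Suc n. x j * p * y j)"
        by (simp add: free_phi_add free_phi_single f(2) mult.assoc pp mult_eq_assoc[OF pp])
      ultimately show ?case by blast
    qed
    then obtain f where f: "f \<in> free_space ?V ?W" "a = free_phi p f"
      using a by metis
    then have "a = phi p (tensor_rel ?V ?W `` {f})" by (simp add: phi_class)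
    moreover have "tensor_rel ?V ?W `` {f} \<in> tensor_space ?V ?W"
      unfolding tensor_space_def by (rule quotientI[OF f(1)])
    ultimately show "a \<in> phi p ` tensor_space ?V ?W" by blast
  qed
  ultimately show ?thesis by (simp add: bij_betw_def)
qed

section \<open>Closure of the tensor operations\<close>

lemma tensor_add_closed:
  assumes "s \<in> tensor_space V W" "t \<in> tensor_space V W"
  shows "tensor_add V W s t \<in> tensor_space V W"
proof -
  obtain f g where f: "f \<in> free_space V W" "s = tensor_rel V W `` {f}"
    and g: "g \<in> free_space V W" "t = tensor_rel V W `` {g}"
    using assms unfolding tensor_space_def by (meson quotientE)
  show ?thesis
    unfolding f(2) g(2) tensor_add_class[OF f(1) g(1)] tensor_space_def
    by (intro quotientI complex_vector.subspace_add[OF subspace_free_space] f g)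
qed

lemma tensor_scale_closed:
  assumes "s \<in> tensor_space V W"
  shows "tensor_scale V W c s \<in> tensor_space V W"
proof -
  obtain f where f: "f \<in> free_space V W" "s = tensor_rel V W `` {f}"
    using assms unfolding tensor_space_def by (meson quotientE)
  show ?thesis
    unfolding f(2) tensor_scale_class[OF f(1)] tensor_space_def
    by (intro quotientI complex_vector.subspace_scale[OF subspace_free_space] f)
qed

lemma tensor_zero_closed: "tensor_zero V W \<in> tensor_space V W"
  unfolding tensor_zero_def tensor_space_def
  by (intro quotientI complex_vector.subspace_0 subspace_free_space)

lemma phi_tensor_zero: "phi p (tensor_zero V W) = 0"
  unfolding tensor_zero_def
  by (simp add: phi_class complex_vector.subspace_0[OF subspace_free_space] free_phi_zero)

section \<open>The direct sum\<close>

text \<open>Evaluating \<open>inv_into\<close> at a sum, product or multiple requires its preimage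
  to be known to lie in the carrier. The record \<open>calg\<close> has no closure axioms, hence the
  three premises.\<close>

lemma alg_isomorphic_if_iso_reverse:
  assumes iso: "alg_iso B C g"
    and add: "\<And>x y. x \<in> alg_carrier B \<Longrightarrow> y \<in> alg_carrier B \<Longrightarrow> alg_add B x y \<in> alg_carrier B"
    and mult: "\<And>x y. x \<in> alg_carrier B \<Longrightarrow> y \<in> alg_carrier B \<Longrightarrow> alg_mult B x y \<in> alg_carrier B"
    and scale: "\<And>c x. x \<in> alg_carrier B \<Longrightarrow> alg_scale B c x \<in> alg_carrier B"
  shows "alg_isomorphic C B"
proof -
  let ?h = "inv_into (alg_carrier B) g"
  have bij: "bij_betw g (alg_carrier B) (alg_carrier C)"
    using iso by (simp add: alg_iso_def)
  have h: "?h y \<in> alg_carrier B" "g (?h y) = y" if "y \<in> alg_carrier C" for y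
    using that bij by (auto simp: bij_betw_def inv_into_into f_inv_into_f)
  have eq: "?h z = x" if "x \<in> alg_carrier B" "g x = z" for x z
    using that bij by (auto simp: bij_betw_def)
  have "alg_iso C B ?h"
    unfolding alg_iso_def
    using iso by (auto simp: alg_iso_def h add mult scale intro!: eq bij_betw_inv_into)
  then show ?thesis by (auto simp: alg_isomorphic_def)
qed

lemma Ap_tensor_pA_simps:
  "alg_carrier (Ap_tensor_pA p) = tensor_space (left_mults p) (right_mults p)"
  "alg_zero (Ap_tensor_pA p) = tensor_zero (left_mults p) (right_mults p)"
  "alg_add (Ap_tensor_pA p) = tensor_add (left_mults p) (right_mults p)"
  "alg_mult (Ap_tensor_pA p) =
    (\<lambda>u v. inv_into (tensor_space (left_mults p) (right_mults p)) (phi p) (phi p u * phi p v))"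
  "alg_scale (Ap_tensor_pA p) = tensor_scale (left_mults p) (right_mults p)"
  by (simp_all add: Ap_tensor_pA_def Let_def)

context
  fixes P :: "'a::complex_banach_algebra_1 set"
  assumes ss: "semisimple TYPE('a)"
    and P: "\<And>p. p \<in> P \<Longrightarrow> minimal_projection p"
    and orth: "\<And>p q x y. p \<in> P \<Longrightarrow> q \<in> P \<Longrightarrow> p \<noteq> q \<Longrightarrow> x \<in> J p \<Longrightarrow> y \<in> J q \<Longrightarrow> x * y = 0"
begin

abbreviation (input) T :: "'a \<Rightarrow> ('a \<times> 'a \<Rightarrow>\<^sub>0 complex) set set" where
  "T p \<equiv> tensor_space (left_mults p) (right_mults p)"

abbreviation (input) D :: "('a \<Rightarrow> ('a \<times> 'a \<Rightarrow>\<^sub>0 complex) set) calg" where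
  "D \<equiv> direct_sum P Ap_tensor_pA"

text \<open>Cutting out the index set by values of \<open>phi\<close> lets sums be handled in A
  alone; on the carrier it is the support of u.\<close>

definition sum_phi :: "('a \<Rightarrow> ('a \<times> 'a \<Rightarrow>\<^sub>0 complex) set) \<Rightarrow> 'a" where
  "sum_phi u = (\<Sum>p | p \<in> P \<and> phi p (u p) \<noteq> 0. phi p (u p))"

lemma phi_in_J: "p \<in> P \<Longrightarrow> t \<in> T p \<Longrightarrow> phi p t \<in> J p"
  using bij_betw_phi[OF ss P] by (auto simp: bij_betw_def)

lemma phi_inj: "p \<in> P \<Longrightarrow> s \<in> T p \<Longrightarrow> t \<in> T p \<Longrightarrow> phi p s = phi p t \<longleftrightarrow> s = t"
  using bij_betw_phi[OF ss P] by (metis bij_betw_def inj_on_eq_iff)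

lemma inv_phi:
  assumes "p \<in> P" "a \<in> J p"
  shows "inv_into (T p) (phi p) a \<in> T p" "phi p (inv_into (T p) (phi p) a) = a"
  using bij_betw_phi[OF ss P[OF assms(1)]] assms(2)
  by (auto simp: bij_betw_def inv_into_into f_inv_into_f)

text \<open>Each \<open>phi p\<close> is injective and sends \<open>tensor_zero\<close> to 0, so
  both descriptions of the support agree.\<close>

lemma mem_carrier_iff:
  "u \<in> alg_carrier D \<longleftrightarrow> u \<in> (\<Pi>\<^sub>E p\<in>P. T p) \<and> finite {p\<in>P. phi p (u p) \<noteq> 0}"
proof -
  have "u p \<noteq> tensor_zero (left_mults p) (right_mults p) \<longleftrightarrow> phi p (u p) \<noteq> 0"
    if "u \<in> (\<Pi>\<^sub>E p\<in>P. T p)" "p \<in> P" for p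
    using phi_inj[OF that(2) PiE_mem[OF that] tensor_zero_closed] by (simp add: phi_tensor_zero)
  then have "u \<in> (\<Pi>\<^sub>E p\<in>P. T p) \<Longrightarrow>
      {p\<in>P. u p \<noteq> tensor_zero (left_mults p) (right_mults p)} = {p\<in>P. phi p (u p) \<noteq> 0}"
    by blast
  then show ?thesis by (auto simp: direct_sum_def Ap_tensor_pA_simps)
qed

lemma phi_operations:
  assumes u: "u \<in> alg_carrier D" and v: "v \<in> alg_carrier D" and p: "p \<in> P"
  shows "alg_add D u v p \<in> T p" "phi p (alg_add D u v p) = phi p (u p) + phi p (v p)"
    and "alg_mult D u v p \<in> T p" "phi p (alg_mult D u v p) = phi p (u p) * phi p (v p)"
    and "alg_scale D c u p \<in> T p" "phi p (alg_scale D c u p) = c *\<^sub>C phi p (u p)"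
proof -
  have uv: "u p \<in> T p" "v p \<in> T p"
    using u v p by (auto simp: mem_carrier_iff)
  \<comment> \<open>The product of tensors is defined by \<open>inv_into\<close>, which is a true
    preimage only on \<open>J p\<close>, the image of \<open>phi p\<close>.\<close>
  then have "phi p (u p) * phi p (v p) \<in> J p"
    using p by (intro J_mult_left phi_in_J)
  note mult = inv_phi[OF p this]
  show "alg_add D u v p \<in> T p" "phi p (alg_add D u v p) = phi p (u p) + phi p (v p)"
    "alg_mult D u v p \<in> T p" "phi p (alg_mult D u v p) = phi p (u p) * phi p (v p)"
    "alg_scale D c u p \<in> T p" "phi p (alg_scale D c u p) = c *\<^sub>C phi p (u p)"
    using uv p mult
    by (simp_all add: direct_sum_def Ap_tensor_pA_simps phi_add phi_scale tensor_add_closed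
        tensor_scale_closed)
qed

lemma carrier_closed:
  assumes u: "u \<in> alg_carrier D" and v: "v \<in> alg_carrier D"
  shows "alg_add D u v \<in> alg_carrier D" "alg_mult D u v \<in> alg_carrier D"
    "alg_scale D c u \<in> alg_carrier D"
proof -
  let ?S = "\<lambda>u. {p\<in>P. phi p (u p) \<noteq> 0}"
  have fin: "finite (?S u \<union> ?S v)" using u v by (simp add: mem_carrier_iff)
  note ops = phi_operations[OF u v]
  have "?S (alg_add D u v) \<subseteq> ?S u \<union> ?S v" "?S (alg_mult D u v) \<subseteq> ?S u \<union> ?S v"
    "?S (alg_scale D c u) \<subseteq> ?S u \<union> ?S v"
    using ops by auto
  then have "finite (?S (alg_add D u v))" "finite (?S (alg_mult D u v))" "finite (?S (alg_scale D c u))"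
    using fin by (blast intro: finite_subset)+
  moreover have "alg_add D u v \<in> (\<Pi>\<^sub>E p\<in>P. T p)" "alg_mult D u v \<in> (\<Pi>\<^sub>E p\<in>P. T p)"
    "alg_scale D c u \<in> (\<Pi>\<^sub>E p\<in>P. T p)"
    using ops(1,3,5) by (auto simp: PiE_iff) (auto simp: direct_sum_def)
  ultimately show "alg_add D u v \<in> alg_carrier D" "alg_mult D u v \<in> alg_carrier D"
    "alg_scale D c u \<in> alg_carrier D"
    unfolding mem_carrier_iff by blast+
qed

lemma sum_phi_superset:
  assumes "finite F" "F \<subseteq> P" "{p\<in>P. phi p (u p) \<noteq> 0} \<subseteq> F"
  shows "sum_phi u = (\<Sum>p\<in>F. phi p (u p))"
  unfolding sum_phi_def using assms by (intro sum.mono_neutral_left) auto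

lemma sum_phi_hom:
  assumes u: "u \<in> alg_carrier D" and v: "v \<in> alg_carrier D"
  shows "sum_phi (alg_add D u v) = sum_phi u + sum_phi v"
    and "sum_phi (alg_mult D u v) = sum_phi u * sum_phi v"
    and "sum_phi (alg_scale D c u) = c *\<^sub>C sum_phi u"
proof -
  let ?F = "{p\<in>P. phi p (u p) \<noteq> 0} \<union> {p\<in>P. phi p (v p) \<noteq> 0}"
  have F: "finite ?F" "?F \<subseteq> P" using u v by (auto simp: mem_carrier_iff)
  note ops = phi_operations[OF u v]
  have eq: "sum_phi w = (\<Sum>p\<in>?F. phi p (w p))" if "{p\<in>P. phi p (w p) \<noteq> 0} \<subseteq> ?F" for w
    by (rule sum_phi_superset[OF F that])
  have su: "sum_phi u = (\<Sum>p\<in>?F. phi p (u p))" and sv: "sum_phi v = (\<Sum>p\<in>?F. phi p (v p))"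
    by (rule eq, blast)+
  have "sum_phi (alg_add D u v) = (\<Sum>p\<in>?F. phi p (alg_add D u v p))"
    using ops by (intro eq) auto
  also have "\<dots> = (\<Sum>p\<in>?F. phi p (u p) + phi p (v p))"
    using ops by (intro sum.cong) auto
  finally show "sum_phi (alg_add D u v) = sum_phi u + sum_phi v"
    by (simp only: su sv sum.distrib)
  have "sum_phi (alg_scale D c u) = (\<Sum>p\<in>?F. phi p (alg_scale D c u p))"
    using ops by (intro eq) auto
  also have "\<dots> = (\<Sum>p\<in>?F. c *\<^sub>C phi p (u p))"
    using ops by (intro sum.cong) auto
  finally show "sum_phi (alg_scale D c u) = c *\<^sub>C sum_phi u"
    by (simp only: su complex_vector.scale_sum_right)
  have "sum_phi u * sum_phi v = (\<Sum>p\<in>?F. \<Sum>q\<in>?F. phi p (u p) * phi q (v q))"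
    by (simp only: su sv sum_product)
  also have "\<dots> = (\<Sum>p\<in>?F. \<Sum>q\<in>?F. if q = p then phi p (u p) * phi p (v p) else 0)"
  proof (intro sum.cong refl)
    fix p q assume "p \<in> ?F" "q \<in> ?F"
    then have pq: "p \<in> P" "q \<in> P" by auto
    then have "phi p (u p) \<in> J p" "phi q (v q) \<in> J q"
      using u v by (auto simp: mem_carrier_iff intro!: phi_in_J)
    then show "phi p (u p) * phi q (v q) = (if q = p then phi p (u p) * phi p (v p) else 0)"
      using orth[OF pq] by auto
  qed
  also have "\<dots> = (\<Sum>p\<in>?F. phi p (u p) * phi p (v p))"
    by (intro sum.cong refl) (simp only: sum.delta[OF F(1)] if_True)
  also have "\<dots> = (\<Sum>p\<in>?F. phi p (alg_mult D u v p))"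
    using ops by (intro sum.cong) auto
  also have "\<dots> = sum_phi (alg_mult D u v)"
    using ops by (intro eq[symmetric]) auto
  finally show "sum_phi (alg_mult D u v) = sum_phi u * sum_phi v" ..
qed

lemma inj_on_sum_phi: "inj_on sum_phi (alg_carrier D)"
proof (rule inj_onI)
  fix u v assume u: "u \<in> alg_carrier D" and v: "v \<in> alg_carrier D" and eq: "sum_phi u = sum_phi v"
  let ?F = "{p\<in>P. phi p (u p) \<noteq> 0} \<union> {p\<in>P. phi p (v p) \<noteq> 0}"
  have F: "finite ?F" "?F \<subseteq> P" using u v by (auto simp: mem_carrier_iff)
  have uv: "u p \<in> T p" "v p \<in> T p" if "p \<in> P" for p
    using u v that by (auto simp: mem_carrier_iff)
  have "sum_phi u = (\<Sum>p\<in>?F. phi p (u p))" "sum_phi v = (\<Sum>p\<in>?F. phi p (v p))"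
    using F by (auto intro!: sum_phi_superset)
  then have sum0: "(\<Sum>p\<in>?F. phi p (u p) - phi p (v p)) = 0"
    using eq by (simp add: sum_subtractf)
  have *: "phi p (u p) - phi p (v p) = 0" if "p \<in> ?F" for p
  proof (rule orthogonal_sum_eq_zero[OF ss F(1) _ _ sum0 that])
    show "phi p (u p) - phi p (v p) \<in> J p" if "p \<in> ?F" for p
      using that uv F(2) by (intro J_diff phi_in_J) auto
  qed (use orth F(2) in blast)
  have "u p = v p" if "p \<in> P" for p
  proof -
    have "phi p (u p) = phi p (v p)"
      using * that by (cases "p \<in> ?F") auto
    then show ?thesis using phi_inj[OF that uv[OF that]] by simp
  qed
  then show "u = v"
    using u v by (auto simp: mem_carrier_iff intro: PiE_ext)
qed

lemma sum_phi_surj: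
  assumes F: "finite F" "F \<subseteq> P" "\<And>p. p \<in> F \<Longrightarrow> f p \<in> J p"
  shows "\<exists>u\<in>alg_carrier D. sum_phi u = sum f F"
proof
  \<comment> \<open>Outside \<open>F\<close> the component is the preimage of 0, which lies in
    \<open>T p\<close> and keeps the support finite.\<close>
  define u where "u = (\<lambda>p\<in>P. inv_into (T p) (phi p) (if p \<in> F then f p else 0))"
  have J: "(if p \<in> F then f p else 0) \<in> J p" for p
    using F(3) by (simp add: J_zero)
  have u: "u p \<in> T p" "phi p (u p) = (if p \<in> F then f p else 0)" if "p \<in> P" for p
    using that inv_phi[OF that J] by (simp_all add: u_def)
  have S: "{p\<in>P. phi p (u p) \<noteq> 0} \<subseteq> F"
    using u(2) by (auto split: if_splits)
  have "u \<in> (\<Pi>\<^sub>E p\<in>P. T p)"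
    using u(1) by (simp add: PiE_iff u_def)
  with S F(1) show "u \<in> alg_carrier D"
    unfolding mem_carrier_iff by (blast intro: finite_subset)
  have "sum_phi u = (\<Sum>p\<in>F. phi p (u p))"
    by (rule sum_phi_superset[OF F(1,2) S])
  also have "\<dots> = sum f F"
    using u(2) F(2) by (intro sum.cong) auto
  finally show "sum_phi u = sum f F" .
qed

lemma alg_iso_sum_phi:
  assumes Soc: "\<And>a. a \<in> Soc \<Longrightarrow> \<exists>F f. finite F \<and> F \<subseteq> P \<and> (\<forall>p\<in>F. f p \<in> J p) \<and> a = (\<Sum>p\<in>F. f p)"
  shows "alg_iso D (Soc_alg :: 'a calg) sum_phi"
proof -
  have "sum_phi ` alg_carrier D = Soc"
  proof (intro equalityI subsetI)
    fix a assume "a \<in> sum_phi ` alg_carrier D"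
    then obtain u where u: "u \<in> alg_carrier D" "a = sum_phi u" by blast
    have "phi p (u p) \<in> Soc" if "p \<in> P" for p
      using u(1) that phi_in_J[of p "u p"] J_subset_Soc[OF ss P[OF that]]
      by (auto simp: mem_carrier_iff)
    then show "a \<in> Soc" unfolding u(2) sum_phi_def by (intro Soc_sum) auto
  next
    fix a :: 'a assume "a \<in> Soc"
    then obtain F f where F: "finite F" "F \<subseteq> P" "\<forall>p\<in>F. f p \<in> J p" "a = sum f F"
      using Soc by blast
    then show "a \<in> sum_phi ` alg_carrier D"
      using sum_phi_surj[of F f] by (metis image_eqI)
  qed
  then show ?thesis
    using inj_on_sum_phi sum_phi_hom
    by (simp add: alg_iso_def bij_betw_def Soc_alg_def)
qed

end

theorem theorem3p1:
  fixes P :: "'a::complex_banach_algebra_1 set"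
  assumes "semisimple TYPE('a)"
    and "\<And>p. p \<in> P \<Longrightarrow> projection p \<and> elem_rank p \<le> 1"
    and "\<And>a. a \<in> Soc \<Longrightarrow> \<exists>F f. finite F \<and> F \<subseteq> P \<and> (\<forall>p\<in>F. f p \<in> J p) \<and> a = (\<Sum>p\<in>F. f p)"
    and "\<And>p q x y. p \<in> P \<Longrightarrow> q \<in> P \<Longrightarrow> p \<noteq> q \<Longrightarrow> x \<in> J p \<Longrightarrow> y \<in> J q \<Longrightarrow>
      x * y = 0 \<and> y * x = 0"
  shows "alg_isomorphic (Soc_alg :: 'a calg) (direct_sum P Ap_tensor_pA)"
proof -
  have P: "\<And>p. p \<in> P \<Longrightarrow> minimal_projection p"
    using assms(1,2) by (blast intro: minimal_projection_if_rank_le_one)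
  have orth: "\<And>p q x y. p \<in> P \<Longrightarrow> q \<in> P \<Longrightarrow> p \<noteq> q \<Longrightarrow> x \<in> J p \<Longrightarrow> y \<in> J q \<Longrightarrow> x * y = 0"
    using assms(4) by blast
  show ?thesis
    by (rule alg_isomorphic_if_iso_reverse[OF alg_iso_sum_phi[OF assms(1) P orth assms(3)]])
      (auto intro: carrier_closed[OF assms(1) P orth])
qed

end
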